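(* Let $R$ be a field of characteristic zero, $n\ge1$ and $0\ne q\in R$. Then $\{I(\lambda):\lambda\text{ a signed partition of }n\}$ is a complete set of pairwise non-isomorphic irreducible $\Sigma_q(n)$-modules.
   Context: A signed composition of $n$ is a sequence $\mu=(\mu_1,\dots,\mu_k)$ of nonzero integers with $\sum|\mu_i|=n$; it is a signed partition if $\mu_1\ge\mu_2\ge\dots\ge\mu_k$. For signed compositions $\mu$ (length $k$) and $\nu$ (length $l$) let $\mathcal N_{\mu\nu}$ be the set of $k\times l$ integer matrices $M=(m_{ij})$ with $\sum_j|m_{ij}|=|\mu_i|$, $\sum_i|m_{ij}|=|\nu_j|$, $m_{ij}\le0$ whenever $\mu_i<0$ or $\nu_j<0$, and $m_{ij}\ge0$ whenever $\mu_i>0$ and $\nu_j>0$. Put $\operatorname{wt}(M)=-\sum_{i:\mu_i<0,\ j:\nu_j<0}m_{ij}$ and let $\operatorname{comp}(M)$ be the signed composition listing the nonzero entries of $M$ row by row, left to right. $d_{\mu\nu\sigma}(x)=\sum_{M\in\mathcal N_{\mu\nu},\ \operatorname{comp}(M)=\sigma}x^{\operatorname{wt}(M)}$. $\Sigma_q(n)$ is the $R$-algebra with generators $\{E_\mu\}$ and relations $E_\mu E_\nu=\sum_\sigma d_{\mu\nu\sigma}(q)E_\sigma$. For a signed composition $\lambda$, $I(\lambda)$ is the one-dimensional $\Sigma_q(n)$-module on which each $E_\alpha$ acts as multiplication by $d_{\lambda\alpha\lambda}(q)$. *)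

theory Defs
  imports "HOL-Library.Poly_Mapping" "HOL-Algebra.QuotRing" "HOL-Algebra.Module"
    "Jordan_Normal_Form.Matrix"
begin

hide_const (open) Multiset.mult

subsection \<open>Signed compositions and structure constants\<close>

definition signed_compositions :: "nat \<Rightarrow> int list set" where
  "signed_compositions n = {\<mu>. 0 \<notin> set \<mu> \<and> (\<Sum>a\<leftarrow>\<mu>. \<bar>a\<bar>) = int n}"

definition signed_partitions :: "nat \<Rightarrow> int list set" where
  "signed_partitions n = {\<mu> \<in> signed_compositions n. sorted_wrt (\<ge>) \<mu>}"

definition NN :: "int list \<Rightarrow> int list \<Rightarrow> int mat set" where
  "NN \<mu> \<nu> = {M \<in> carrier_mat (length \<mu>) (length \<nu>).
     (\<forall>i<length \<mu>. (\<Sum>j<length \<nu>. \<bar>M $$ (i, j)\<bar>) = \<bar>\<mu> ! i\<bar>) \<and>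
     (\<forall>j<length \<nu>. (\<Sum>i<length \<mu>. \<bar>M $$ (i, j)\<bar>) = \<bar>\<nu> ! j\<bar>) \<and>
     (\<forall>i<length \<mu>. \<forall>j<length \<nu>.
        (\<mu> ! i < 0 \<or> \<nu> ! j < 0 \<longrightarrow> M $$ (i, j) \<le> 0) \<and>
        (\<mu> ! i > 0 \<and> \<nu> ! j > 0 \<longrightarrow> M $$ (i, j) \<ge> 0))}"

text \<open>For \<open>M \<in> NN \<mu> \<nu>\<close> every summand is nonpositive, so \<^const>\<open>nat\<close> does not truncate.\<close>

definition wt_mat :: "int list \<Rightarrow> int list \<Rightarrow> int mat \<Rightarrow> nat" where
  "wt_mat \<mu> \<nu> M =
     nat (- (\<Sum>(i, j)\<in>{(i, j). i < length \<mu> \<and> j < length \<nu> \<and> \<mu> ! i < 0 \<and> \<nu> ! j < 0}. M $$ (i, j)))"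

definition comp_mat :: "int mat \<Rightarrow> int list" where
  "comp_mat M = filter (\<lambda>a. a \<noteq> 0) (concat (mat_to_list M))"

text \<open>The value at \<open>x\<close> of the polynomial \<open>d\<^bsub>\<mu>\<nu>\<sigma>\<^esub>\<close>; the index set is finite, since the
  entries of \<open>M\<close> are bounded in absolute value by the parts of \<open>\<mu>\<close>.\<close>

definition d_coeff :: "int list \<Rightarrow> int list \<Rightarrow> int list \<Rightarrow> 'r::comm_semiring_1 \<Rightarrow> 'r" where
  "d_coeff \<mu> \<nu> \<sigma> x = (\<Sum>M\<in>{M \<in> NN \<mu> \<nu>. comp_mat M = \<sigma>}. x ^ wt_mat \<mu> \<nu> M)"


subsection \<open>The algebra given by generators and relations\<close>

datatype 'g word = Word (letters: "'g list")

text \<open>\<^typ>\<open>'g word\<close> is the free monoid under concatenation, written additively because the product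
  of \<^typ>\<open>('w, 'r) poly_mapping\<close> is the convolution over an additive monoid. Hence
  \<^typ>\<open>('g word, 'r) poly_mapping\<close> is the free unital associative algebra on \<^typ>\<open>'g\<close>.\<close>

instantiation word :: (type) monoid_add
begin

definition zero_word :: "'a word" where
  "zero_word = Word []"

definition plus_word :: "'a word \<Rightarrow> 'a word \<Rightarrow> 'a word" where
  "plus_word u v = Word (letters u @ letters v)"

instance
  by standard (simp_all add: zero_word_def plus_word_def)

end

type_synonym 'r free = "(int list word, 'r) poly_mapping"

definition free_algebra :: "nat \<Rightarrow> 'r::field free ring" where
  "free_algebra n =
     \<lparr>carrier = {f. \<forall>w\<in>Poly_Mapping.keys f. set (letters w) \<subseteq> signed_compositions n},
      mult = (*), one = 1, zero = 0, add = (+)\<rparr>"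

definition gen :: "int list \<Rightarrow> 'r::field free" where
  "gen \<mu> = Poly_Mapping.single (Word [\<mu>]) 1"

definition scalar :: "'r::field \<Rightarrow> 'r free" where
  "scalar c = Poly_Mapping.single 0 c"

text \<open>The relations \<open>E\<^bsub>\<mu>\<^esub> E\<^bsub>\<nu>\<^esub> = (\<Sum>\<sigma>. d\<^bsub>\<mu>\<nu>\<sigma>\<^esub>(q) E\<^bsub>\<sigma>\<^esub>)\<close> make \<open>E\<^bsub>(n)\<^esub>\<close> a two-sided identity for
  the span of the generators. The last relator says that it is the identity element of the algebra.
  Without it the unital algebra on these generators would have an extra direct factor, spanned by
  \<open>1 - E\<^bsub>(n)\<^esub>\<close> and annihilated by every generator.\<close>

definition relators :: "nat \<Rightarrow> 'r::field \<Rightarrow> 'r free set" where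
  "relators n q =
     {gen \<mu> * gen \<nu> - (\<Sum>\<sigma>\<in>signed_compositions n. scalar (d_coeff \<mu> \<nu> \<sigma> q) * gen \<sigma>) | \<mu> \<nu>.
        \<mu> \<in> signed_compositions n \<and> \<nu> \<in> signed_compositions n}
     \<union> {gen [int n] - 1}"

definition rel_ideal :: "nat \<Rightarrow> 'r::field \<Rightarrow> 'r free set" where
  "rel_ideal n q = Idl\<^bsub>free_algebra n\<^esub> (relators n q)"

definition Sigma_alg :: "nat \<Rightarrow> 'r::field \<Rightarrow> 'r free set ring" where
  "Sigma_alg n q = free_algebra n Quot rel_ideal n q"

text \<open>The images in the quotient of the generators and of the scalars.\<close>

definition E_gen :: "nat \<Rightarrow> 'r::field \<Rightarrow> int list \<Rightarrow> 'r free set" where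
  "E_gen n q \<mu> = rel_ideal n q +>\<^bsub>free_algebra n\<^esub> gen \<mu>"

definition scalar_Sigma :: "nat \<Rightarrow> 'r::field \<Rightarrow> 'r \<Rightarrow> 'r free set" where
  "scalar_Sigma n q c = rel_ideal n q +>\<^bsub>free_algebra n\<^esub> scalar c"


subsection \<open>Modules over a not necessarily commutative ring\<close>

text \<open>The locale \<^locale>\<open>module\<close> requires a commutative ring of scalars. As there, the fields
  \<^const>\<open>mult\<close> and \<^const>\<open>one\<close> of the record \<open>M\<close> play no role. A module over an algebra is a
  module over its underlying ring; the scalars act through their image in the algebra.\<close>

locale left_module = R?: ring R + M?: abelian_group M
  for R (structure) and M :: "('a, 'm, 'z) module_scheme" (structure) +
  assumes smult_closed: "\<lbrakk>a \<in> carrier R; x \<in> carrier M\<rbrakk> \<Longrightarrow> a \<odot>\<^bsub>M\<^esub> x \<in> carrier M"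
    and smult_l_distr: "\<lbrakk>a \<in> carrier R; b \<in> carrier R; x \<in> carrier M\<rbrakk>
      \<Longrightarrow> (a \<oplus>\<^bsub>R\<^esub> b) \<odot>\<^bsub>M\<^esub> x = a \<odot>\<^bsub>M\<^esub> x \<oplus>\<^bsub>M\<^esub> b \<odot>\<^bsub>M\<^esub> x"
    and smult_r_distr: "\<lbrakk>a \<in> carrier R; x \<in> carrier M; y \<in> carrier M\<rbrakk>
      \<Longrightarrow> a \<odot>\<^bsub>M\<^esub> (x \<oplus>\<^bsub>M\<^esub> y) = a \<odot>\<^bsub>M\<^esub> x \<oplus>\<^bsub>M\<^esub> a \<odot>\<^bsub>M\<^esub> y"
    and smult_assoc: "\<lbrakk>a \<in> carrier R; b \<in> carrier R; x \<in> carrier M\<rbrakk>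
      \<Longrightarrow> (a \<otimes>\<^bsub>R\<^esub> b) \<odot>\<^bsub>M\<^esub> x = a \<odot>\<^bsub>M\<^esub> (b \<odot>\<^bsub>M\<^esub> x)"
    and smult_one: "x \<in> carrier M \<Longrightarrow> \<one>\<^bsub>R\<^esub> \<odot>\<^bsub>M\<^esub> x = x"

definition irreducible_module ::
    "('a, 'b) ring_scheme \<Rightarrow> ('a, 'm, 'z) module_scheme \<Rightarrow> bool" where
  "irreducible_module R M \<longleftrightarrow>
     left_module R M \<and> carrier M \<noteq> {\<zero>\<^bsub>M\<^esub>} \<and>
     (\<forall>H. submodule H R M \<longrightarrow> H = {\<zero>\<^bsub>M\<^esub>} \<or> H = carrier M)"

definition module_isomorphic ::
    "('a, 'b) ring_scheme \<Rightarrow> ('a, 'm, 'y) module_scheme \<Rightarrow> ('a, 'k, 'z) module_scheme \<Rightarrow> bool" where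
  "module_isomorphic R M N \<longleftrightarrow>
     (\<exists>h \<in> iso (add_monoid M) (add_monoid N).
        \<forall>a\<in>carrier R. \<forall>x\<in>carrier M. h (a \<odot>\<^bsub>M\<^esub> x) = a \<odot>\<^bsub>N\<^esub> h x)"


subsection \<open>The one-dimensional modules\<close>

text \<open>The algebra homomorphism from the free algebra to the field with
  \<open>E\<^bsub>\<alpha>\<^esub> \<mapsto> d\<^bsub>\<kappa>\<alpha>\<kappa>\<^esub>(q)\<close>. For \<open>\<kappa>\<close> a signed composition of \<open>n\<close> it
  vanishes on the relators, so it is constant on each coset.\<close>

definition eval_free :: "'r::field \<Rightarrow> int list \<Rightarrow> 'r free \<Rightarrow> 'r" where
  "eval_free q \<kappa> f =
     (\<Sum>w\<in>Poly_Mapping.keys f. Poly_Mapping.lookup f w * (\<Prod>\<alpha>\<leftarrow>letters w. d_coeff \<kappa> \<alpha> \<kappa> q))"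

definition I_mod :: "'r::field \<Rightarrow> int list \<Rightarrow> ('r free set, 'r) module" where
  "I_mod q \<kappa> =
     \<lparr>carrier = UNIV, mult = (*), one = 1, zero = 0, add = (+),
      smult = (\<lambda>X v. the_elem (eval_free q \<kappa> ` X) * v)\<rparr>"

end

theory Submission
  imports Defs
begin

text \<open>Writing \<open>w(\<alpha>)\<close> for the sum of the absolute values of the negative parts of \<open>\<alpha>\<close>, one has
  \<open>d\<^bsub>\<kappa>\<alpha>\<kappa>\<^esub>(q) = q\<^bsup>w(\<alpha>)\<^esup> N(\<kappa>, \<alpha>)\<close>, where \<open>N(\<kappa>, \<alpha>)\<close> counts the ways of distributing the parts of
  \<open>\<kappa>\<close> over the parts of \<open>\<alpha>\<close>. Pairs of such distributions over \<open>\<mu>\<close> and \<open>\<nu>\<close> are distributions over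
  the nonzero cells of a matrix in \<open>NN \<mu> \<nu>\<close>, so \<open>E\<^bsub>\<alpha>\<^esub> \<mapsto> d\<^bsub>\<kappa>\<alpha>\<kappa>\<^esub>(q)\<close> respects the relations. In
  characteristic zero and for \<open>q \<noteq> 0\<close>, equal characters force \<open>\<kappa>\<close> and \<open>\<mu>\<close> to refine each other,
  hence to be rearrangements of each other.

  For completeness, note that \<open>E\<^bsub>\<mu>\<^esub> E\<^bsub>\<nu>\<^esub>\<close> is \<open>d\<^bsub>\<mu>\<nu>\<mu>\<^esub>(q) E\<^bsub>\<mu>\<^esub>\<close> plus terms \<open>E\<^bsub>\<sigma>\<^esub>\<close> with \<open>\<sigma>\<close> of higher
  rank. Given an irreducible \<open>M\<close>, take \<open>\<sigma>\<close> of maximal rank with \<open>E\<^bsub>\<sigma>\<^esub> M \<noteq> 0\<close>. Then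
  \<open>E\<^bsub>\<sigma>\<^esub> a x = \<chi>\<^bsub>\<sigma>\<^esub>(a) E\<^bsub>\<sigma>\<^esub> x\<close> for all \<open>a\<close> and \<open>x\<close>, so the kernel of \<open>E\<^bsub>\<sigma>\<^esub>\<close> is a proper submodule, hence
  zero, and \<open>a\<close> acts on \<open>M\<close> as the scalar \<open>\<chi>\<^bsub>\<sigma>\<^esub>(a)\<close>.\<close>

subsection \<open>Refinement maps\<close>

text \<open>\<open>refine_maps I a J b\<close> is the set of ways of distributing the signed parts \<open>a i\<close> over
  blocks of sizes \<open>\<bar>b j\<bar>\<close> such that negative blocks receive only negative parts.\<close>

definition refine_maps :: "'i set \<Rightarrow> ('i \<Rightarrow> int) \<Rightarrow> 'j set \<Rightarrow> ('j \<Rightarrow> int) \<Rightarrow> ('i \<Rightarrow> 'j) set" where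
  "refine_maps I a J b =
     {f \<in> I \<rightarrow>\<^sub>E J. (\<forall>j\<in>J. (\<Sum>i\<in>{i \<in> I. f i = j}. \<bar>a i\<bar>) = \<bar>b j\<bar>) \<and> (\<forall>i\<in>I. b (f i) < 0 \<longrightarrow> a i < 0)}"

abbreviation list_refinements :: "int list \<Rightarrow> int list \<Rightarrow> (nat \<Rightarrow> nat) set" where
  "list_refinements \<kappa> \<alpha> \<equiv> refine_maps {..<length \<kappa>} ((!) \<kappa>) {..<length \<alpha>} ((!) \<alpha>)"

lemma finite_refine_maps: "finite I \<Longrightarrow> finite J \<Longrightarrow> finite (refine_maps I a J b)"
  unfolding refine_maps_def by (rule finite_subset[of _ "I \<rightarrow>\<^sub>E J"]) (auto intro: finite_PiE)

text \<open>Composition with \<open>p\<close> after a map is a bijection between the two sets. This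
  allows blocks to be indexed by the nonzero cells of a matrix instead of by list positions.\<close>

lemma card_refine_maps_target:
  assumes p: "bij_betw p J' J"
  shows "card (refine_maps I a J' (b \<circ> p)) = card (refine_maps I a J b)"
proof (rule bij_betw_same_card[of "\<lambda>f. restrict (p \<circ> f) I"])
  have inj: "p x = p y \<longleftrightarrow> x = y" if "x \<in> J'" "y \<in> J'" for x y
    using p that by (auto simp: bij_betw_def inj_on_def)
  have im: "J = p ` J'" using p by (simp add: bij_betw_def)
  define s where "s = inv_into J' p"
  have s: "s x \<in> J'" "p (s x) = x" if "x \<in> J" for x
    using that p unfolding s_def bij_betw_def by (auto intro: inv_into_into f_inv_into_f)
  have sp: "s (p x) = x" if "x \<in> J'" for x
    using p that unfolding s_def bij_betw_def by simp
  show "bij_betw (\<lambda>f. restrict (p \<circ> f) I) (refine_maps I a J' (b \<circ> p)) (refine_maps I a J b)"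
  proof (rule bij_betw_byWitness[of _ "\<lambda>g. restrict (s \<circ> g) I"])
    show "\<forall>f\<in>refine_maps I a J' (b \<circ> p). restrict (s \<circ> restrict (p \<circ> f) I) I = f"
      by (auto simp: refine_maps_def PiE_def extensional_def fun_eq_iff sp Pi_iff)
    show "\<forall>g\<in>refine_maps I a J b. restrict (p \<circ> restrict (s \<circ> g) I) I = g"
      by (auto simp: refine_maps_def PiE_def extensional_def fun_eq_iff s Pi_iff)
    show "(\<lambda>f. restrict (p \<circ> f) I) ` refine_maps I a J' (b \<circ> p) \<subseteq> refine_maps I a J b"
    proof clarify
      fix f assume f: "f \<in> refine_maps I a J' (b \<circ> p)"
      then have fJ: "\<And>i. i \<in> I \<Longrightarrow> f i \<in> J'" by (auto simp: refine_maps_def)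
      have "{i \<in> I. restrict (p \<circ> f) I i = p j} = {i \<in> I. f i = j}" if "j \<in> J'" for j
        using that fJ inj by auto
      then show "restrict (p \<circ> f) I \<in> refine_maps I a J b"
        using f fJ by (auto simp: refine_maps_def im)
    qed
    show "(\<lambda>g. restrict (s \<circ> g) I) ` refine_maps I a J b \<subseteq> refine_maps I a J' (b \<circ> p)"
    proof clarify
      fix g assume g: "g \<in> refine_maps I a J b"
      then have gJ: "\<And>i. i \<in> I \<Longrightarrow> g i \<in> J" by (auto simp: refine_maps_def)
      have "{i \<in> I. restrict (s \<circ> g) I i = j} = {i \<in> I. g i = p j}" if "j \<in> J'" for j
        using that gJ sp s by force
      then show "restrict (s \<circ> g) I \<in> refine_maps I a J' (b \<circ> p)"
        using g gJ s by (auto simp: refine_maps_def im)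
    qed
  qed
qed

text \<open>Here the bijection is composition with the inverse of \<open>p\<close> before a map.
  Consequently the count depends on the distributed parts only up to rearrangement.\<close>

lemma card_refine_maps_source:
  assumes p: "bij_betw p I' I"
  shows "card (refine_maps I' (a \<circ> p) J b) = card (refine_maps I a J b)"
proof (rule bij_betw_same_card[of "\<lambda>f. restrict (f \<circ> inv_into I' p) I"])
  define s where "s = inv_into I' p"
  have im: "I = p ` I'" using p by (simp add: bij_betw_def)
  have s: "s x \<in> I'" "p (s x) = x" if "x \<in> I" for x
    using that p unfolding s_def bij_betw_def by (auto intro: inv_into_into f_inv_into_f)
  have pI: "p x \<in> I" if "x \<in> I'" for x using im that by auto
  have sp: "s (p x) = x" if "x \<in> I'" for x
    using p that unfolding s_def bij_betw_def by simp
  have sum_eq: "(\<Sum>i\<in>{i \<in> I'. P (p i)}. \<bar>a (p i)\<bar>) = (\<Sum>i\<in>{i \<in> I. P i}. \<bar>a i\<bar>)" for P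
    by (rule sum.reindex_bij_witness[of _ s p]) (auto simp: s sp pI)
  show "bij_betw (\<lambda>f. restrict (f \<circ> inv_into I' p) I) (refine_maps I' (a \<circ> p) J b) (refine_maps I a J b)"
    unfolding s_def[symmetric]
  proof (rule bij_betw_byWitness[of _ "\<lambda>g. restrict (g \<circ> p) I'"])
    show "\<forall>f\<in>refine_maps I' (a \<circ> p) J b. restrict (restrict (f \<circ> s) I \<circ> p) I' = f"
      by (auto simp: refine_maps_def PiE_def extensional_def fun_eq_iff sp pI)
    show "\<forall>g\<in>refine_maps I a J b. restrict (restrict (g \<circ> p) I' \<circ> s) I = g"
      by (auto simp: refine_maps_def PiE_def extensional_def fun_eq_iff s)
    show "(\<lambda>f. restrict (f \<circ> s) I) ` refine_maps I' (a \<circ> p) J b \<subseteq> refine_maps I a J b"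
    proof clarify
      fix f assume f: "f \<in> refine_maps I' (a \<circ> p) J b"
      have "{i \<in> I'. f (s (p i)) = j} = {i \<in> I'. f i = j}" for j using sp by auto
      then have "(\<Sum>i\<in>{i \<in> I. f (s i) = j}. \<bar>a i\<bar>) = (\<Sum>i\<in>{i \<in> I'. f i = j}. \<bar>a (p i)\<bar>)" for j
        using sum_eq[of "\<lambda>i. f (s i) = j"] by simp
      moreover have "{i \<in> I. restrict (f \<circ> s) I i = j} = {i \<in> I. f (s i) = j}" for j by auto
      ultimately show "restrict (f \<circ> s) I \<in> refine_maps I a J b"
        using f s by (fastforce simp: refine_maps_def)
    qed
    show "(\<lambda>g. restrict (g \<circ> p) I') ` refine_maps I a J b \<subseteq> refine_maps I' (a \<circ> p) J b"
    proof clarify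
      fix g assume g: "g \<in> refine_maps I a J b"
      have "{i \<in> I'. restrict (g \<circ> p) I' i = j} = {i \<in> I'. g (p i) = j}" for j by auto
      then have "(\<Sum>i\<in>{i \<in> I'. restrict (g \<circ> p) I' i = j}. \<bar>a (p i)\<bar>) = (\<Sum>i\<in>{i \<in> I. g i = j}. \<bar>a i\<bar>)" for j
        using sum_eq[of "\<lambda>i. g i = j"] by simp
      then show "restrict (g \<circ> p) I' \<in> refine_maps I' (a \<circ> p) J b"
        using g pI by (auto simp: refine_maps_def)
    qed
  qed
qed

subsection \<open>Matrices with prescribed row and column sums\<close>

text \<open>This is the exponent \<open>w(\<alpha>)\<close>: \<open>nat\<close> sends the negation
  of a positive part to 0, so only negative parts contribute.\<close>

definition negw :: "int list \<Rightarrow> nat" where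
  "negw \<alpha> = (\<Sum>x\<leftarrow>\<alpha>. nat (- x))"

text \<open>The product list runs row by row, which is the order in which \<open>comp_mat\<close>
  reads the entries.\<close>

definition cells :: "int mat \<Rightarrow> (nat \<times> nat) list" where
  "cells M = filter (\<lambda>c. M $$ c \<noteq> 0) (List.product [0..<dim_row M] [0..<dim_col M])"

lemma comp_mat_cells: "comp_mat M = map (($$) M) (cells M)"
  by (simp add: comp_mat_def cells_def mat_to_list_def product_concat_map filter_concat map_concat
      filter_map o_def)

lemma set_cells: "set (cells M) = {(i, j). i < dim_row M \<and> j < dim_col M \<and> M $$ (i, j) \<noteq> 0}"
  by (auto simp: cells_def)

lemma distinct_cells: "distinct (cells M)"
  by (simp add: cells_def distinct_product)

text \<open>The condition on \<open>f 0\<close> makes the zero entries, which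
  \<open>comp_mat\<close> drops, harmless in the double sum.\<close>

lemma sum_comp_mat:
  fixes f :: "int \<Rightarrow> 'b::comm_monoid_add"
  assumes "M \<in> carrier_mat k l" "f 0 = 0"
  shows "(\<Sum>x\<leftarrow>comp_mat M. f x) = (\<Sum>i<k. \<Sum>j<l. f (M $$ (i, j)))"
proof -
  have "(\<Sum>x\<leftarrow>comp_mat M. f x) = (\<Sum>c\<in>set (cells M). f (M $$ c))"
    by (simp add: comp_mat_cells o_def sum_list_distinct_conv_sum_set distinct_cells)
  also have "\<dots> = (\<Sum>c\<in>{..<k} \<times> {..<l}. f (M $$ c))"
    using assms by (intro sum.mono_neutral_left) (auto simp: set_cells)
  finally show ?thesis by (simp add: sum.cartesian_product)
qed

lemma comp_mat_signed_composition:
  assumes \<mu>: "\<mu> \<in> signed_compositions n" and M: "M \<in> NN \<mu> \<nu>"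
  shows "comp_mat M \<in> signed_compositions n"
proof -
  have "(\<Sum>x\<leftarrow>comp_mat M. \<bar>x\<bar>) = (\<Sum>i<length \<mu>. \<Sum>j<length \<nu>. \<bar>M $$ (i, j)\<bar>)"
    using M by (intro sum_comp_mat) (auto simp: NN_def)
  also have "\<dots> = (\<Sum>x\<leftarrow>\<mu>. \<bar>x\<bar>)"
    using M by (auto simp: NN_def sum_list_sum_nth atLeast0LessThan)
  finally show ?thesis
    using \<mu> by (auto simp: signed_compositions_def comp_mat_def)
qed

text \<open>Nonzero parts have absolute value at least 1, which bounds the length by n, and each
  part is bounded by the total.\<close>

lemma finite_signed_compositions: "finite (signed_compositions n)"
proof (rule finite_subset)
  show "signed_compositions n \<subseteq> {xs. set xs \<subseteq> {- int n..int n} \<and> length xs \<le> n}"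
  proof
    fix \<mu> assume \<mu>: "\<mu> \<in> signed_compositions n"
    have "1 \<le> \<bar>x\<bar>" if "x \<in> set \<mu>" for x
      using \<mu> that by (cases "x = 0") (auto simp: signed_compositions_def)
    then have "(\<Sum>x\<leftarrow>\<mu>. 1::int) \<le> (\<Sum>x\<leftarrow>\<mu>. \<bar>x\<bar>)"
      by (intro sum_list_mono)
    then have "length \<mu> \<le> n"
      using \<mu> by (simp add: signed_compositions_def sum_list_triv)
    moreover have "- int n \<le> x \<and> x \<le> int n" if "x \<in> set \<mu>" for x
    proof -
      have "\<bar>x\<bar> \<le> (\<Sum>a\<leftarrow>\<mu>. \<bar>a\<bar>)"
        using that by (intro member_le_sum_list) auto
      also have "\<dots> = int n" using \<mu> by (simp add: signed_compositions_def)
      finally show ?thesis by linarith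
    qed
    ultimately show "\<mu> \<in> {xs. set xs \<subseteq> {- int n..int n} \<and> length xs \<le> n}"
      by (simp add: subset_iff)
  qed
qed (simp add: finite_lists_length_le)

lemma NN_nonpos:
  assumes "M \<in> NN \<mu> \<nu>" "i < length \<mu>" "j < length \<nu>" "\<mu> ! i < 0 \<or> \<nu> ! j < 0"
  shows "M $$ (i, j) \<le> 0"
  using assms unfolding NN_def by blast

lemma NN_entry_le:
  assumes "M \<in> NN \<mu> \<nu>" "i < length \<mu>" "j < length \<nu>"
  shows "\<bar>M $$ (i, j)\<bar> \<le> \<bar>\<mu> ! i\<bar>"
proof -
  have "\<bar>M $$ (i, j)\<bar> \<le> (\<Sum>j<length \<nu>. \<bar>M $$ (i, j)\<bar>)"
    using assms by (intro member_le_sum) auto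
  then show ?thesis using assms by (simp add: NN_def)
qed

lemma finite_NN: "finite (NN \<mu> \<nu>)"
proof (rule finite_subset)
  define B where "B = (\<Sum>x\<leftarrow>\<mu>. \<bar>x\<bar>)"
  let ?I = "{..<length \<mu>} \<times> {..<length \<nu>}"
  show "NN \<mu> \<nu> \<subseteq> mat (length \<mu>) (length \<nu>) ` (?I \<rightarrow>\<^sub>E {- B..B})"
  proof
    fix M assume M: "M \<in> NN \<mu> \<nu>"
    have "- B \<le> M $$ (i, j) \<and> M $$ (i, j) \<le> B" if "i < length \<mu>" "j < length \<nu>" for i j
    proof -
      have "\<bar>M $$ (i, j)\<bar> \<le> \<bar>\<mu> ! i\<bar>" using NN_entry_le[OF M that] .
      also have "\<dots> \<le> B"
        unfolding B_def using that by (intro member_le_sum_list) auto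
      finally show ?thesis by linarith
    qed
    then have "restrict (($$) M) ?I \<in> ?I \<rightarrow>\<^sub>E {- B..B}"
      by (auto simp: Pi_iff)
    moreover have "M = mat (length \<mu>) (length \<nu>) (restrict (($$) M) ?I)"
      using M by (intro eq_matI) (auto simp: NN_def)
    ultimately show "M \<in> mat (length \<mu>) (length \<nu>) ` (?I \<rightarrow>\<^sub>E {- B..B})" by blast
  qed
qed (auto intro!: finite_imageI finite_PiE)

text \<open>The identity holds cell by cell. If row and column are both negative, the absolute value
  of the entry occurs twice on each side; if exactly one is negative, the entry is nonpositive and
  occurs once on each side; otherwise it is nonnegative and does not occur at all.\<close>

lemma wt_mat_negw:
  assumes M: "M \<in> NN \<mu> \<nu>" and nz: "0 \<notin> set \<mu>" "0 \<notin> set \<nu>"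
  shows "wt_mat \<mu> \<nu> M + negw (comp_mat M) = negw \<mu> + negw \<nu>"
proof -
  let ?k = "length \<mu>" and ?l = "length \<nu>"
  let ?m = "\<lambda>i j. \<bar>M $$ (i, j)\<bar>"
  note Md = M[unfolded NN_def, simplified]
  have "- (\<Sum>(i, j)\<in>{(i, j). i < ?k \<and> j < ?l \<and> \<mu> ! i < 0 \<and> \<nu> ! j < 0}. M $$ (i, j))
     = (\<Sum>c\<in>{(i, j). i < ?k \<and> j < ?l \<and> \<mu> ! i < 0 \<and> \<nu> ! j < 0}. \<bar>M $$ c\<bar>)"
    using Md by (subst sum_negf[symmetric], intro sum.cong) auto
  also have "\<dots> = (\<Sum>c\<in>{..<?k} \<times> {..<?l}. if \<mu> ! fst c < 0 \<and> \<nu> ! snd c < 0 then ?m (fst c) (snd c) else 0)"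
    by (subst sum.inter_filter[symmetric]) (auto intro!: sum.cong)
  also have "\<dots> = (\<Sum>i<?k. \<Sum>j<?l. if \<mu> ! i < 0 \<and> \<nu> ! j < 0 then ?m i j else 0)"
    by (simp add: sum.cartesian_product case_prod_unfold)
  finally have wt: "int (wt_mat \<mu> \<nu> M) = (\<Sum>i<?k. \<Sum>j<?l. if \<mu> ! i < 0 \<and> \<nu> ! j < 0 then ?m i j else 0)"
    by (simp add: wt_mat_def sum_nonneg)
  have comp: "int (negw (comp_mat M)) = (\<Sum>i<?k. \<Sum>j<?l. int (nat (- M $$ (i, j))))"
    using sum_comp_mat[of M ?k ?l "\<lambda>x. nat (- x)"] Md by (simp add: negw_def)
  have "int (negw \<mu>) = (\<Sum>i<?k. if \<mu> ! i < 0 then \<bar>\<mu> ! i\<bar> else 0)"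
    by (auto simp: negw_def sum_list_sum_nth atLeast0LessThan intro!: sum.cong)
  also have "\<dots> = (\<Sum>i<?k. if \<mu> ! i < 0 then \<Sum>j<?l. ?m i j else 0)"
    using Md by (intro sum.cong) auto
  also have "\<dots> = (\<Sum>i<?k. \<Sum>j<?l. if \<mu> ! i < 0 then ?m i j else 0)"
    by (intro sum.cong) auto
  finally have mu: "int (negw \<mu>) = \<dots>" .
  have "int (negw \<nu>) = (\<Sum>j<?l. if \<nu> ! j < 0 then \<bar>\<nu> ! j\<bar> else 0)"
    by (auto simp: negw_def sum_list_sum_nth atLeast0LessThan intro!: sum.cong)
  also have "\<dots> = (\<Sum>j<?l. if \<nu> ! j < 0 then \<Sum>i<?k. ?m i j else 0)"
    using Md by (intro sum.cong) auto
  also have "\<dots> = (\<Sum>j<?l. \<Sum>i<?k. if \<nu> ! j < 0 then ?m i j else 0)"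
    by (intro sum.cong) auto
  also have "\<dots> = (\<Sum>i<?k. \<Sum>j<?l. if \<nu> ! j < 0 then ?m i j else 0)"
    by (rule sum.swap)
  finally have nu: "int (negw \<nu>) = \<dots>" .
  have nz': "\<mu> ! i \<noteq> 0" "\<nu> ! j \<noteq> 0" if "i < ?k" "j < ?l" for i j
    using nz nth_mem that by metis+
  have "(if \<mu> ! i < 0 \<and> \<nu> ! j < 0 then ?m i j else 0) + int (nat (- M $$ (i, j)))
     = (if \<mu> ! i < 0 then ?m i j else 0) + (if \<nu> ! j < 0 then ?m i j else 0)"
    if "i < ?k" "j < ?l" for i j
    using Md nz'[OF that] that by (smt (verit) nat_0_le int_nat_eq)
  then have "int (wt_mat \<mu> \<nu> M) + int (negw (comp_mat M)) = int (negw \<mu>) + int (negw \<nu>)"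
    unfolding wt comp mu nu sum.distrib[symmetric] by (intro sum.cong refl) auto
  then show ?thesis by linarith
qed

subsection \<open>Triangularity\<close>

definition comp_row :: "int mat \<Rightarrow> nat \<Rightarrow> int list" where
  "comp_row M i = filter (\<lambda>a. a \<noteq> 0) (map (\<lambda>j. M $$ (i, j)) [0..<dim_col M])"

lemma comp_mat_rows: "comp_mat M = concat (map (comp_row M) [0..<dim_row M])"
  by (simp add: comp_mat_def comp_row_def comp_row_def[abs_def] mat_to_list_def filter_concat o_def)

text \<open>A row belonging to a positive part may consist of a single negative entry, so the length alone
  does not detect every proper refinement; weighting negative parts by \<open>2\<close> does.\<close>

definition rank :: "int list \<Rightarrow> nat" where
  "rank \<mu> = (\<Sum>x\<leftarrow>\<mu>. if x < 0 then 2 else 1)"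

lemma rank_concat: "rank (concat xss) = (\<Sum>xs\<leftarrow>xss. rank xs)"
  by (induction xss) (auto simp: rank_def)

text \<open>A row with nonzero sum is nonempty after filtering, and a negative part admits only
  negative entries, so the rank cannot drop. Equal rank leaves room for a single entry of the same
  sign, and the row sum fixes its absolute value.\<close>

lemma rank_row:
  assumes M: "M \<in> NN \<mu> \<nu>" and i: "i < length \<mu>" and nz: "\<mu> ! i \<noteq> 0"
  shows "rank (comp_row M i) \<ge> rank [\<mu> ! i]"
    and "rank (comp_row M i) = rank [\<mu> ! i] \<Longrightarrow> comp_row M i = [\<mu> ! i]"
proof -
  have "(\<Sum>x\<leftarrow>comp_row M i. \<bar>x\<bar>) = (\<Sum>x\<leftarrow>map (\<lambda>j. M $$ (i, j)) [0..<dim_col M]. \<bar>x\<bar>)"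
    unfolding comp_row_def by (rule sum_list_map_filter) auto
  also have "\<dots> = (\<Sum>j<length \<nu>. \<bar>M $$ (i, j)\<bar>)"
    using M by (auto simp: NN_def interv_sum_list_conv_sum_set_nat atLeast0LessThan o_def)
  also have "\<dots> = \<bar>\<mu> ! i\<bar>" using M i by (simp add: NN_def)
  finally have s: "(\<Sum>x\<leftarrow>comp_row M i. \<bar>x\<bar>) = \<bar>\<mu> ! i\<bar>" .
  then obtain a as where row: "comp_row M i = a # as" using nz by (cases "comp_row M i") auto
  have neg: "x < 0" if x: "x \<in> set (comp_row M i)" "\<mu> ! i < 0" for x
  proof -
    obtain j where "j < length \<nu>" "x = M $$ (i, j)" "x \<noteq> 0"
      using x M by (auto simp: comp_row_def NN_def)
    moreover from this have "M $$ (i, j) \<le> 0"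
      using M i x by (auto simp: NN_def)
    ultimately show ?thesis by simp
  qed
  have neg_a: "a < 0" if "\<mu> ! i < 0" using neg[of a] that by (simp add: row)
  then show "rank (comp_row M i) \<ge> rank [\<mu> ! i]"
    by (auto simp: rank_def row)
  assume eq: "rank (comp_row M i) = rank [\<mu> ! i]"
  have "length as \<le> rank as" 
    unfolding rank_def by (induction as) auto
  moreover have "rank as = 0" using eq neg_a by (auto simp: rank_def row split: if_splits)
  ultimately have "as = []" by simp
  with s eq have "\<bar>a\<bar> = \<bar>\<mu> ! i\<bar>" "a < 0 \<longleftrightarrow> \<mu> ! i < 0"
    by (auto simp: row rank_def split: if_splits)
  then show "comp_row M i = [\<mu> ! i]" using \<open>as = []\<close> by (auto simp: row)
qed

text \<open>The rank is additive over rows and no row loses rank, so equality of the totals forces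
  equality in every row.\<close>

lemma rank_comp_mat:
  assumes M: "M \<in> NN \<mu> \<nu>" and nz: "0 \<notin> set \<mu>"
  shows "rank (comp_mat M) \<ge> rank \<mu>"
    and "rank (comp_mat M) = rank \<mu> \<Longrightarrow> i < length \<mu> \<Longrightarrow> comp_row M i = [\<mu> ! i]"
    and "rank (comp_mat M) = rank \<mu> \<Longrightarrow> comp_mat M = \<mu>"
proof -
  have nz': "\<mu> ! i \<noteq> 0" if "i < length \<mu>" for i using nz nth_mem that by metis
  have [simp]: "dim_row M = length \<mu>" using M by (auto simp: NN_def)
  have "rank (comp_mat M) = (\<Sum>i\<leftarrow>[0..<length \<mu>]. rank (comp_row M i))"
    by (simp add: comp_mat_rows rank_concat o_def)
  then have r: "rank (comp_mat M) = (\<Sum>i<length \<mu>. rank (comp_row M i))"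
    by (simp add: interv_sum_list_conv_sum_set_nat atLeast0LessThan)
  have r\<mu>: "rank \<mu> = (\<Sum>i<length \<mu>. rank [\<mu> ! i])"
    by (simp add: rank_def sum_list_sum_nth atLeast0LessThan)
  show "rank (comp_mat M) \<ge> rank \<mu>"
    unfolding r r\<mu> by (intro sum_mono) (use rank_row(1)[OF M] nz' in auto)
  have row: "comp_row M i = [\<mu> ! i]" if "rank (comp_mat M) = rank \<mu>" "i < length \<mu>" for i
  proof -
    have "rank (comp_row M i) = rank [\<mu> ! i]"
    proof (rule ccontr)
      assume "rank (comp_row M i) \<noteq> rank [\<mu> ! i]"
      then have "rank [\<mu> ! i] < rank (comp_row M i)" using rank_row(1)[OF M] nz' that by fastforce
      then have "(\<Sum>i<length \<mu>. rank [\<mu> ! i]) < (\<Sum>i<length \<mu>. rank (comp_row M i))"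
        by (intro sum_strict_mono_ex1) (use rank_row(1)[OF M] nz' that in auto)
      then show False using that r r\<mu> by simp
    qed
    then show ?thesis using rank_row(2)[OF M] nz' that by blast
  qed
  then show "rank (comp_mat M) = rank \<mu> \<Longrightarrow> i < length \<mu> \<Longrightarrow> comp_row M i = [\<mu> ! i]" .
  assume "rank (comp_mat M) = rank \<mu>"
  then have "map (comp_row M) [0..<length \<mu>] = map (\<lambda>x. [x]) \<mu>"
    by (intro nth_equalityI) (auto simp: row)
  then show "comp_mat M = \<mu>" by (simp add: comp_mat_rows)
qed

text \<open>A nonzero coefficient needs at least one matrix with composition
  \<open>\<sigma>\<close>, to which the rank estimate applies. This is the triangularity of left
  multiplication by \<open>gen \<mu>\<close>.\<close>

lemma d_coeff_nonzero_rank: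
  assumes "0 \<notin> set \<mu>" "d_coeff \<mu> \<nu> \<sigma> q \<noteq> 0" "\<sigma> \<noteq> \<mu>"
  shows "rank \<sigma> > rank \<mu>"
proof -
  have "{M \<in> NN \<mu> \<nu>. comp_mat M = \<sigma>} \<noteq> {}"
    using assms(2) unfolding d_coeff_def by (metis sum.empty)
  then obtain M where "M \<in> NN \<mu> \<nu>" "comp_mat M = \<sigma>" by blast
  then show ?thesis using rank_comp_mat(1,3)[of M \<mu> \<nu>] assms by fastforce
qed

subsection \<open>Mutual refinement\<close>

text \<open>Signed totals can only grow along a refinement: a negative block contains negative parts
  only, so its sum is exact, and for any other block the signed sum is at most the sum of absolute
  values.\<close>

lemma sum_fibre_mono:
  fixes I :: "'i set"
  assumes f: "f \<in> refine_maps I a J b" and I: "finite I" and J: "finite J"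
  shows "(\<Sum>i\<in>I. a i) \<le> (\<Sum>j\<in>J. b j)"
proof -
  have "(\<Sum>i\<in>I. a i) = (\<Sum>j\<in>J. \<Sum>i\<in>{i \<in> I. f i = j}. a i)"
    using f by (intro sum.group[symmetric] I J) (auto simp: refine_maps_def)
  also have "\<dots> \<le> (\<Sum>j\<in>J. b j)"
  proof (rule sum_mono)
    fix j assume j: "j \<in> J"
    have s: "(\<Sum>i\<in>{i \<in> I. f i = j}. \<bar>a i\<bar>) = \<bar>b j\<bar>" using f j by (simp add: refine_maps_def)
    show "(\<Sum>i\<in>{i \<in> I. f i = j}. a i) \<le> b j"
    proof (cases "b j < 0")
      case True
      have "(\<Sum>i\<in>{i \<in> I. f i = j}. a i) = (\<Sum>i\<in>{i \<in> I. f i = j}. - \<bar>a i\<bar>)"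
        using f True by (intro sum.cong) (auto simp: refine_maps_def)
      then show ?thesis using s True by (simp add: sum_negf)
    next
      case False
      have "(\<Sum>i\<in>{i \<in> I. f i = j}. a i) \<le> (\<Sum>i\<in>{i \<in> I. f i = j}. \<bar>a i\<bar>)"
        by (intro sum_mono) auto
      then show ?thesis using s False by simp
    qed
  qed
  finally show ?thesis .
qed

lemma refinement_surj:
  assumes f: "f \<in> refine_maps I a J b" and b: "\<And>j. j \<in> J \<Longrightarrow> b j \<noteq> 0"
  shows "f ` I = J"
proof
  show "f ` I \<subseteq> J" using f by (auto simp: refine_maps_def)
  show "J \<subseteq> f ` I"
  proof
    fix j assume j: "j \<in> J"
    then have "(\<Sum>i\<in>{i \<in> I. f i = j}. \<bar>a i\<bar>) \<noteq> 0" using f b by (auto simp: refine_maps_def)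
    then have "{i \<in> I. f i = j} \<noteq> {}" by (metis sum.empty)
    then show "j \<in> f ` I" by auto
  qed
qed

text \<open>Surjectivity in both directions equates the lengths, so \<open>f\<close> is a bijection
  of positions preserving absolute values. It can only turn negative parts into positive ones, and
  comparing signed totals by means of \<open>g\<close> excludes that.\<close>

lemma mset_eq_of_mutual_refinements:
  assumes f: "f \<in> list_refinements \<kappa> \<mu>" and g: "g \<in> list_refinements \<mu> \<kappa>"
    and nz: "0 \<notin> set \<kappa>" "0 \<notin> set \<mu>"
  shows "mset \<kappa> = mset \<mu>"
proof -
  let ?k = "length \<kappa>" and ?l = "length \<mu>"
  have im: "f ` {..<?k} = {..<?l}" "g ` {..<?l} = {..<?k}"
    using refinement_surj[OF f] refinement_surj[OF g] nz nth_mem by (metis lessThan_iff)+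
  have "?l \<le> ?k" "?k \<le> ?l"
    using im card_image_le[of "{..<?k}" f] card_image_le[of "{..<?l}" g] by auto
  then have len: "?k = ?l" by simp
  have inj: "inj_on f {..<?k}" using im len by (intro eq_card_imp_inj_on) auto
  have fl: "f i < ?l" if "i < ?k" for i using im that by blast
  have abs: "\<bar>\<kappa> ! i\<bar> = \<bar>\<mu> ! f i\<bar>" if "i < ?k" for i
  proof -
    have "{i' \<in> {..<?k}. f i' = f i} = {i}" using inj that by (auto simp: inj_on_def)
    moreover have "(\<Sum>i'\<in>{i' \<in> {..<?k}. f i' = f i}. \<bar>\<kappa> ! i'\<bar>) = \<bar>\<mu> ! f i\<bar>"
      using f fl[OF that] by (auto simp: refine_maps_def)
    ultimately show ?thesis by simp
  qed
  have le: "\<kappa> ! i \<le> \<mu> ! f i" if "i < ?k" for i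
  proof -
    have "\<mu> ! f i < 0 \<longrightarrow> \<kappa> ! i < 0" using f that by (auto simp: refine_maps_def)
    then show ?thesis using abs[OF that] by linarith
  qed
  have sum_f: "(\<Sum>i<?k. \<mu> ! f i) = (\<Sum>j<?l. \<mu> ! j)"
    using sum.reindex[OF inj, of "(!) \<mu>"] im by simp
  have eq: "\<kappa> ! i = \<mu> ! f i" if "i < ?k" for i
  proof (rule ccontr)
    assume "\<kappa> ! i \<noteq> \<mu> ! f i"
    then have "(\<Sum>i<?k. \<kappa> ! i) < (\<Sum>i<?k. \<mu> ! f i)"
      using le that by (intro sum_strict_mono_ex1) (auto simp: order.strict_iff_order)
    \<comment> \<open>The second refinement supplies the reverse inequality of totals, so no single
      part can increase strictly.\<close>
    moreover have "(\<Sum>j<?l. \<mu> ! j) \<le> (\<Sum>i<?k. \<kappa> ! i)"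
      using sum_fibre_mono[OF g] by simp
    ultimately show False using sum_f by simp
  qed
  have "image_mset ((!) \<kappa>) (mset_set {..<?k}) = image_mset ((!) \<mu>) (image_mset f (mset_set {..<?k}))"
    by (auto simp: multiset.map_comp o_def eq intro!: image_mset_cong)
  also have "image_mset f (mset_set {..<?k}) = mset_set {..<?l}"
    using image_mset_mset_set[OF inj] im by simp
  finally have "image_mset ((!) \<kappa>) (mset_set {..<?k}) = image_mset ((!) \<mu>) (mset_set {..<?l})" .
  moreover have "image_mset ((!) xs) (mset_set {..<length xs}) = mset xs" for xs :: "int list"
    by (metis map_nth mset_map mset_set_upto_eq_mset_upto atLeast0LessThan)
  ultimately show ?thesis by simp
qed

text \<open>Reversal turns the decreasing order into the increasing one, where sorting determines
  the list from its multiset.\<close>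

lemma signed_partition_eqI:
  assumes "\<kappa> \<in> signed_partitions n" "\<mu> \<in> signed_partitions n" "mset \<kappa> = mset \<mu>"
  shows "\<kappa> = \<mu>"
proof -
  have "sort (rev \<kappa>) = rev \<mu>" "sort (rev \<kappa>) = rev \<kappa>"
    using assms by (auto intro!: properties_for_sort simp: signed_partitions_def sorted_wrt_rev)
  then show ?thesis by simp
qed

text \<open>The identity on positions is a witness. It makes the diagonal value of each character at
  its own index nonzero when q is nonzero and the characteristic is zero.\<close>

lemma list_refinements_refl: "0 \<notin> set \<kappa> \<Longrightarrow> list_refinements \<kappa> \<kappa> \<noteq> {}"
proof -
  have "{i. i < length \<kappa> \<and> restrict (\<lambda>i. i) {..<length \<kappa>} i = j} = {j}" if "j < length \<kappa>" for j
    using that by auto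
  then have "restrict (\<lambda>i. i) {..<length \<kappa>} \<in> list_refinements \<kappa> \<kappa>"
    by (auto simp: refine_maps_def)
  then show ?thesis by blast
qed

text \<open>Through \<open>d_coeff_diag\<close> this shows that rearranging \<open>\<kappa>\<close>
  does not change its character.\<close>

lemma card_list_refinements_perm:
  assumes "mset \<kappa> = mset \<sigma>"
  shows "card (list_refinements \<kappa> \<alpha>) = card (list_refinements \<sigma> \<alpha>)"
proof -
  obtain p where p: "p permutes {..<length \<sigma>}" "permute_list p \<sigma> = \<kappa>"
    using mset_eq_permutation[OF assms] .
  have len: "length \<kappa> = length \<sigma>" using assms mset_eq_length by blast
  have "f \<in> list_refinements \<kappa> \<alpha> \<longleftrightarrow> f \<in> refine_maps {..<length \<sigma>} ((!) \<sigma> \<circ> p) {..<length \<alpha>} ((!) \<alpha>)" for f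
  proof -
    have "\<kappa> ! i = \<sigma> ! p i" if "i < length \<sigma>" for i
      using permute_list_nth[OF p(1)] p(2) that by auto
    then show ?thesis unfolding refine_maps_def len by (auto intro!: sum.cong)
  qed
  then show ?thesis
    using card_refine_maps_source[OF permutes_imp_bij[OF p(1)], of "(!) \<sigma>"] by (metis subsetI subset_antisym)
qed

subsection \<open>The diagonal structure constants\<close>

lemma filter_eq_singleton: "distinct xs \<Longrightarrow> x \<in> set xs \<Longrightarrow> filter ((=) x) xs = [x]"
  by (induction xs) (auto simp: filter_empty_conv)

text \<open>A matrix whose composition is \<open>\<kappa>\<close> again has one nonzero entry in
  each row, and the columns of these entries form a refinement map. All such matrices have the same
  weight, because \<open>negw \<kappa>\<close> cancels in \<open>wt_mat_negw\<close>.\<close>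

lemma d_coeff_diag:
  assumes nz: "0 \<notin> set \<kappa>" "0 \<notin> set \<alpha>"
  shows "d_coeff \<kappa> \<alpha> \<kappa> q = q ^ negw \<alpha> * of_nat (card (list_refinements \<kappa> \<alpha>))"
proof -
  let ?k = "length \<kappa>" and ?l = "length \<alpha>"
  define S where "S = {M \<in> NN \<kappa> \<alpha>. comp_mat M = \<kappa>}"
  define F where "F = (\<lambda>f. mat ?k ?l (\<lambda>(i, j). if f i = j then \<kappa> ! i else 0))"
  have nz': "\<kappa> ! i \<noteq> 0" if "i < ?k" for i using nz nth_mem that by metis
  have col: "(\<Sum>i<?k. \<bar>if f i = j then \<kappa> ! i else 0\<bar>) = (\<Sum>i\<in>{i \<in> {..<?k}. f i = j}. \<bar>\<kappa> ! i\<bar>)"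
    for f :: "nat \<Rightarrow> nat" and j
    by (subst sum.inter_filter) (auto intro!: sum.cong)
  have "bij_betw F (list_refinements \<kappa> \<alpha>) S"
  proof (rule bij_betw_imageI)
    show "inj_on F (list_refinements \<kappa> \<alpha>)"
    proof (rule inj_onI)
      fix f g assume f: "f \<in> list_refinements \<kappa> \<alpha>" and g: "g \<in> list_refinements \<kappa> \<alpha>" and eq: "F f = F g"
      have "f i = g i" if i: "i < ?k" for i
      proof -
        have fi: "f i < ?l" using f i by (auto simp: refine_maps_def)
        then have "F f $$ (i, f i) = F g $$ (i, f i)" using eq by simp
        then show ?thesis using i fi nz'[OF i] by (auto simp: F_def split: if_splits)
      qed
      moreover have "f i = g i" if "\<not> i < ?k" for i
        using f g that by (auto simp: refine_maps_def PiE_def extensional_def)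
      ultimately show "f = g" by blast
    qed
    show "F ` list_refinements \<kappa> \<alpha> = S"
    proof (intro equalityI subsetI)
      fix M assume "M \<in> F ` list_refinements \<kappa> \<alpha>"
      then obtain f where f: "f \<in> list_refinements \<kappa> \<alpha>" and M: "M = F f" by blast
      have fl: "f i < ?l" if "i < ?k" for i using f that by (auto simp: refine_maps_def)
      have row: "(\<Sum>j<?l. \<bar>if f i = j then \<kappa> ! i else 0\<bar>) = \<bar>\<kappa> ! i\<bar>" if "i < ?k" for i
      proof -
        have "(\<Sum>j<?l. \<bar>if f i = j then \<kappa> ! i else 0\<bar>) = (\<Sum>j<?l. if f i = j then \<bar>\<kappa> ! i\<bar> else 0)"
          by (intro sum.cong) auto
        then show ?thesis using fl[OF that] by simp
      qed
      have "M \<in> NN \<kappa> \<alpha>"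
        using f row unfolding M F_def NN_def by (auto simp: col refine_maps_def)
      moreover have "comp_row M i = [\<kappa> ! i]" if i: "i < ?k" for i
      proof -
        have "filter (\<lambda>j. f i = j) [0..<?l] = [f i]"
          using fl[OF i] by (intro filter_eq_singleton) auto
        moreover have "comp_row M i = map (\<lambda>j. M $$ (i, j)) (filter (\<lambda>j. f i = j) [0..<?l])"
          using i nz'[OF i] by (auto simp: comp_row_def M F_def filter_map o_def split: if_splits intro!: arg_cong[of _ _ "map _"] filter_cong)
        ultimately show ?thesis using i fl by (simp add: M F_def)
      qed
      then have "map (comp_row M) [0..<?k] = map (\<lambda>x. [x]) \<kappa>"
        by (intro nth_equalityI) auto
      then have "comp_mat M = \<kappa>" by (simp add: comp_mat_rows M F_def)
      ultimately show "M \<in> S" by (simp add: S_def)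
    next
      fix M assume "M \<in> S"
      then have M: "M \<in> NN \<kappa> \<alpha>" and comp: "comp_mat M = \<kappa>" by (auto simp: S_def)
      have [simp]: "dim_row M = ?k" "dim_col M = ?l" using M by (auto simp: NN_def)
      \<comment> \<open>Since \<open>comp_mat M\<close> and \<open>\<kappa>\<close> have equal rank,
        \<open>rank_comp_mat\<close> leaves a single nonzero entry in row \<open>i\<close>. The map
        \<open>f\<close> chosen below records its column.\<close>
      have "\<exists>j<?l. M $$ (i, j) = \<kappa> ! i \<and> (\<forall>j'<?l. j' \<noteq> j \<longrightarrow> M $$ (i, j') = 0)" if i: "i < ?k" for i
      proof -
        have "map (\<lambda>j. M $$ (i, j)) (filter (\<lambda>j. M $$ (i, j) \<noteq> 0) [0..<?l]) = [\<kappa> ! i]"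
          using rank_comp_mat(2)[OF M nz(1) _ i] comp by (simp add: comp_row_def filter_map o_def)
        then obtain j where j: "filter (\<lambda>j. M $$ (i, j) \<noteq> 0) [0..<?l] = [j]" "M $$ (i, j) = \<kappa> ! i"
          by auto
        have "{j. j < ?l \<and> M $$ (i, j) \<noteq> 0} = {j}"
          using arg_cong[OF j(1), of set] by auto
        then show ?thesis using j(2) by blast
      qed
      then obtain f where f: "\<And>i. i < ?k \<Longrightarrow> f i < ?l \<and> M $$ (i, f i) = \<kappa> ! i \<and> (\<forall>j'<?l. j' \<noteq> f i \<longrightarrow> M $$ (i, j') = 0)"
        by metis
      have entry: "M $$ (i, j) = (if f i = j then \<kappa> ! i else 0)" if "i < ?k" "j < ?l" for i j
        using f[OF that(1)] that(2) by auto
      let ?f = "restrict f {..<?k}"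
      have "M = F ?f" by (intro eq_matI) (auto simp: F_def entry)
      moreover have "?f \<in> list_refinements \<kappa> \<alpha>"
      proof -
        have "(\<Sum>i\<in>{i \<in> {..<?k}. ?f i = j}. \<bar>\<kappa> ! i\<bar>) = \<bar>\<alpha> ! j\<bar>" if "j < ?l" for j
        proof -
          have "\<bar>\<alpha> ! j\<bar> = (\<Sum>i<?k. \<bar>M $$ (i, j)\<bar>)" using M that by (simp add: NN_def)
          also have "\<dots> = (\<Sum>i<?k. \<bar>if ?f i = j then \<kappa> ! i else 0\<bar>)"
            using that by (intro sum.cong) (auto simp: entry)
          finally show ?thesis unfolding col by simp
        qed
        \<comment> \<open>A negative column forces its entries to be nonpositive, and this entry is
          a nonzero part of \<open>\<kappa>\<close>.\<close>
        moreover have "\<kappa> ! i < 0" if "i < ?k" "\<alpha> ! f i < 0" for i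
        proof -
          have "M $$ (i, f i) \<le> 0" using NN_nonpos[OF M, of i "f i"] f[OF that(1)] that by blast
          then show ?thesis using f[OF that(1)] nz'[OF that(1)] by auto
        qed
        ultimately show ?thesis using f by (auto simp: refine_maps_def)
      qed
      ultimately show "M \<in> F ` list_refinements \<kappa> \<alpha>" by blast
    qed
  qed
  then have card: "card (list_refinements \<kappa> \<alpha>) = card S" by (rule bij_betw_same_card)
  have "wt_mat \<kappa> \<alpha> M = negw \<alpha>" if "M \<in> S" for M
    using wt_mat_negw[OF _ nz, of M] that by (auto simp: S_def)
  then show ?thesis
    unfolding d_coeff_def S_def[symmetric] card by (simp add: mult.commute)
qed

section \<open>Multiplicativity of the refinement counts and of the characters\<close>

lemma refine_maps_cong:
  assumes "\<And>j. j \<in> J \<Longrightarrow> b j = b' j"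
  shows "refine_maps I a J b = refine_maps I a J b'"
  using assms unfolding refine_maps_def by (intro Collect_cong) (auto simp: PiE_iff)

text \<open>Indexing the blocks by cells lets a block be read as a pair of a row and a column, which
  is how two refinements are combined.\<close>

lemma card_list_refinements_comp_mat:
  "card (list_refinements \<kappa> (comp_mat M)) = card (refine_maps {..<length \<kappa>} ((!) \<kappa>) (set (cells M)) (($$) M))"
proof -
  have "bij_betw ((!) (cells M)) {..<length (cells M)} (set (cells M))"
    by (rule bij_betw_nth[OF distinct_cells]) auto
  moreover have "list_refinements \<kappa> (comp_mat M)
      = refine_maps {..<length \<kappa>} ((!) \<kappa>) {..<length (cells M)} (($$) M \<circ> (!) (cells M))"
    by (simp add: comp_mat_cells) (rule refine_maps_cong, simp)
  ultimately show ?thesis by (simp add: card_refine_maps_target)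
qed

text \<open>A pair \<open>(f, g)\<close> of refinements corresponds to the matrix \<open>M\<close> whose entry \<open>(i, j)\<close> is, up to sign,
  the total size of the parts that \<open>f\<close> sends to \<open>i\<close> and \<open>g\<close> sends to \<open>j\<close>, together with the
  map \<open>t \<mapsto> (f t, g t)\<close> to the nonzero cells of \<open>M\<close>.\<close>

lemma card_list_refinements_mult:
  assumes nz: "0 \<notin> set \<kappa>" "0 \<notin> set \<mu>" "0 \<notin> set \<nu>"
  shows "card (list_refinements \<kappa> \<mu>) * card (list_refinements \<kappa> \<nu>)
    = (\<Sum>M\<in>NN \<mu> \<nu>. card (list_refinements \<kappa> (comp_mat M)))"
proof -
  let ?I = "{..<length \<kappa>}" and ?k = "length \<mu>" and ?l = "length \<nu>"
  \<comment> \<open>The sign that membership in \<open>NN \<mu> \<nu>\<close> prescribes for a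
    nonzero entry at \<open>(i, j)\<close>.\<close>
  define sg where "sg i j = (if \<mu> ! i < 0 \<or> \<nu> ! j < 0 then - 1 else (1::int))" for i j
  define S where "S f g i j = (\<Sum>t\<in>{t \<in> ?I. f t = i \<and> g t = j}. \<bar>\<kappa> ! t\<bar>)" for f g :: "nat \<Rightarrow> nat" and i j
  define MM where "MM f g = mat ?k ?l (\<lambda>(i, j). sg i j * S f g i j)" for f g
  define X where "X M = refine_maps ?I ((!) \<kappa>) (set (cells M)) (($$) M)" for M
  define \<Phi> where "\<Phi> = (\<lambda>(f, g). (MM f g, restrict (\<lambda>t. (f t, g t)) ?I))"
  define \<Psi> where "\<Psi> = (\<lambda>(M :: int mat, h :: nat \<Rightarrow> nat \<times> nat). (restrict (fst \<circ> h) ?I, restrict (snd \<circ> h) ?I))"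
  have nz': "\<kappa> ! t \<noteq> 0" if "t < length \<kappa>" for t using nz nth_mem that by metis
  have nz\<mu>: "\<mu> ! t \<noteq> 0" if "t < ?k" for t using nz nth_mem that by metis
  have nz\<nu>: "\<nu> ! t \<noteq> 0" if "t < ?l" for t using nz nth_mem that by metis
  have S_nonneg: "0 \<le> S f g i j" for f g i j by (simp add: S_def sum_nonneg)
  have abs_sg: "\<bar>sg i j * S f g i j\<bar> = S f g i j" for f g i j
    using S_nonneg[of f g i j] by (simp add: abs_mult sg_def)
  have S_row: "(\<Sum>j<?l. S f g i j) = (\<Sum>t\<in>{t \<in> ?I. f t = i}. \<bar>\<kappa> ! t\<bar>)"
    if "\<forall>t\<in>?I. g t < ?l" for f g i
  proof -
    have "(\<Sum>j<?l. \<Sum>t\<in>{t \<in> {t \<in> ?I. f t = i}. g t = j}. \<bar>\<kappa> ! t\<bar>) = (\<Sum>t\<in>{t \<in> ?I. f t = i}. \<bar>\<kappa> ! t\<bar>)"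
      using that by (intro sum.group) auto
    then show ?thesis by (simp add: S_def conj_assoc)
  qed
  have S_swap: "S f g i j = S g f j i" for f g i j
    unfolding S_def by (intro sum.cong) auto
  have S_col: "(\<Sum>i<?k. S f g i j) = (\<Sum>t\<in>{t \<in> ?I. g t = j}. \<bar>\<kappa> ! t\<bar>)"
    if "\<forall>t\<in>?I. f t < ?k" for f g j
  proof -
    have "(\<Sum>i<?k. \<Sum>t\<in>{t \<in> {t \<in> ?I. g t = j}. f t = i}. \<bar>\<kappa> ! t\<bar>) = (\<Sum>t\<in>{t \<in> ?I. g t = j}. \<bar>\<kappa> ! t\<bar>)"
      using that by (intro sum.group) auto
    then show ?thesis by (subst S_swap) (simp add: S_def conj_assoc)
  qed
  have cellsD: "fst c < ?k" "snd c < ?l" "M $$ c \<noteq> 0" if "M \<in> NN \<mu> \<nu>" "c \<in> set (cells M)" for M c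
    using that by (auto simp: set_cells NN_def)
  \<comment> \<open>At a nonzero cell this is the block condition on \<open>h\<close>; at a zero
    entry both sides vanish because \<open>h\<close> takes values in nonzero cells only.\<close>
  have S_X: "S (restrict (fst \<circ> h) ?I) (restrict (snd \<circ> h) ?I) i j = \<bar>M $$ (i, j)\<bar>"
    if M: "M \<in> NN \<mu> \<nu>" and h: "h \<in> X M" and ij: "i < ?k" "j < ?l" for M h i j
  proof -
    have eq: "S (restrict (fst \<circ> h) ?I) (restrict (snd \<circ> h) ?I) i j = (\<Sum>t\<in>{t \<in> ?I. h t = (i, j)}. \<bar>\<kappa> ! t\<bar>)"
      unfolding S_def by (intro sum.cong) (auto simp: prod_eq_iff)
    show ?thesis
    proof (cases "M $$ (i, j) = 0")
      case False
      then have "(i, j) \<in> set (cells M)" using M ij by (auto simp: set_cells NN_def)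
      then show ?thesis using h unfolding eq by (simp add: X_def refine_maps_def)
    next
      case True
      have "h t \<in> set (cells M)" if "t \<in> ?I" for t using h that by (auto simp: X_def refine_maps_def)
      then have "h t \<noteq> (i, j)" if "t \<in> ?I" for t using cellsD(3)[OF M] True that by metis
      then have empty: "{t \<in> ?I. h t = (i, j)} = {}" by blast
      show ?thesis unfolding eq True empty by simp
    qed
  qed
  have "bij_betw \<Phi> (list_refinements \<kappa> \<mu> \<times> list_refinements \<kappa> \<nu>) (SIGMA M:NN \<mu> \<nu>. X M)"
  proof (rule bij_betw_byWitness[of _ \<Psi>])
    show "\<forall>fg\<in>list_refinements \<kappa> \<mu> \<times> list_refinements \<kappa> \<nu>. \<Psi> (\<Phi> fg) = fg"
      by (auto simp: \<Phi>_def \<Psi>_def refine_maps_def PiE_def extensional_def fun_eq_iff)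
    show "\<forall>Mh\<in>SIGMA M:NN \<mu> \<nu>. X M. \<Phi> (\<Psi> Mh) = Mh"
    proof clarify
      fix M h assume M: "M \<in> NN \<mu> \<nu>" and h: "h \<in> X M"
      have "sg i j * \<bar>M $$ (i, j)\<bar> = M $$ (i, j)" if "i < ?k" "j < ?l" for i j
        using M nz\<mu>[OF that(1)] nz\<nu>[OF that(2)] that by (auto simp: sg_def NN_def)
      then have "MM (restrict (fst \<circ> h) ?I) (restrict (snd \<circ> h) ?I) = M"
        using M by (intro eq_matI) (auto simp: MM_def S_X[OF M h] NN_def)
      then show "\<Phi> (\<Psi> (M, h)) = (M, h)"
        using h by (auto simp: \<Phi>_def \<Psi>_def X_def refine_maps_def PiE_def extensional_def fun_eq_iff)
    qed
    show "\<Phi> ` (list_refinements \<kappa> \<mu> \<times> list_refinements \<kappa> \<nu>) \<subseteq> (SIGMA M:NN \<mu> \<nu>. X M)"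
    proof clarify
      fix f g M h assume f: "f \<in> list_refinements \<kappa> \<mu>" and g: "g \<in> list_refinements \<kappa> \<nu>"
        and "(M, h) = \<Phi> (f, g)"
      then have M: "M = MM f g" and h: "h = restrict (\<lambda>t. (f t, g t)) ?I" by (auto simp: \<Phi>_def)
      have fk: "f t < ?k" and gl: "g t < ?l" if "t \<in> ?I" for t
        using f g that by (auto simp: refine_maps_def)
      have entry: "M $$ (i, j) = sg i j * S f g i j" if "i < ?k" "j < ?l" for i j
        using that by (simp add: M MM_def)
      have MN: "M \<in> NN \<mu> \<nu>"
      proof -
        have "(\<Sum>j<?l. \<bar>M $$ (i, j)\<bar>) = \<bar>\<mu> ! i\<bar>" if "i < ?k" for i
          using that S_row[of g f i] gl f by (simp add: entry abs_sg refine_maps_def)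
        moreover have "(\<Sum>i<?k. \<bar>M $$ (i, j)\<bar>) = \<bar>\<nu> ! j\<bar>" if "j < ?l" for j
          using that S_col[of f g j] fk g by (simp add: entry abs_sg refine_maps_def)
        moreover have "M \<in> carrier_mat ?k ?l" by (simp add: M MM_def)
        ultimately show ?thesis
          using S_nonneg by (auto simp: NN_def entry sg_def)
      qed
      \<comment> \<open>The part \<open>t\<close> itself lies in this cell, so the entry there is
        nonzero and the pair is an admissible value of \<open>h\<close>.\<close>
      have S_pos: "0 < S f g (f t) (g t)" if "t \<in> ?I" for t
      proof -
        have "\<bar>\<kappa> ! t\<bar> \<le> S f g (f t) (g t)"
          unfolding S_def using that by (intro member_le_sum) auto
        then show ?thesis using nz' that by (smt (verit) lessThan_iff)
      qed
      have cell: "(f t, g t) \<in> set (cells M)" if "t \<in> ?I" for t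
        using S_pos[OF that] fk[OF that] gl[OF that] entry[of "f t" "g t"]
        by (auto simp: set_cells M MM_def sg_def)
      have "(\<Sum>t\<in>{t \<in> ?I. h t = c}. \<bar>\<kappa> ! t\<bar>) = \<bar>M $$ c\<bar>" if "c \<in> set (cells M)" for c
      proof -
        obtain i j where c: "c = (i, j)" "i < ?k" "j < ?l"
          using cellsD[OF MN] \<open>c \<in> set (cells M)\<close> by (cases c) auto
        have "(\<Sum>t\<in>{t \<in> ?I. h t = c}. \<bar>\<kappa> ! t\<bar>) = S f g i j"
          unfolding S_def c h by (intro sum.cong) auto
        then show ?thesis by (simp add: c entry abs_sg)
      qed
      \<comment> \<open>A negative entry comes from a negative row or column, so the sign condition
        of \<open>f\<close> or of \<open>g\<close> applies.\<close>
      moreover have "\<kappa> ! t < 0" if "t \<in> ?I" "M $$ (f t, g t) < 0" for t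
      proof -
        have "\<mu> ! f t < 0 \<or> \<nu> ! g t < 0"
          using that S_nonneg[of f g "f t" "g t"] fk gl by (auto simp: entry sg_def split: if_splits)
        then show ?thesis using f g that by (auto simp: refine_maps_def)
      qed
      ultimately have "h \<in> X M"
        using cell unfolding X_def refine_maps_def by (auto simp: h)
      then show "M \<in> NN \<mu> \<nu> \<and> h \<in> X M" using MN by simp
    qed
    show "\<Psi> ` (SIGMA M:NN \<mu> \<nu>. X M) \<subseteq> list_refinements \<kappa> \<mu> \<times> list_refinements \<kappa> \<nu>"
    proof clarify
      fix M h f g assume M: "M \<in> NN \<mu> \<nu>" and h: "h \<in> X M" and "(f, g) = \<Psi> (M, h)"
      then have f: "f = restrict (fst \<circ> h) ?I" and g: "g = restrict (snd \<circ> h) ?I" by (auto simp: \<Psi>_def)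
      have hc: "h t \<in> set (cells M)" if "t \<in> ?I" for t using h that by (auto simp: X_def refine_maps_def)
      have fk: "f t < ?k" and gl: "g t < ?l" if "t \<in> ?I" for t
        using cellsD[OF M hc[OF that]] that by (auto simp: f g)
      have S: "S f g i j = \<bar>M $$ (i, j)\<bar>" if "i < ?k" "j < ?l" for i j
        using S_X[OF M h that] by (simp add: f g)
      have row: "(\<Sum>t\<in>{t \<in> ?I. f t = i}. \<bar>\<kappa> ! t\<bar>) = \<bar>\<mu> ! i\<bar>" if "i < ?k" for i
        using M that S_row[of g f i] gl by (simp add: S NN_def)
      have col: "(\<Sum>t\<in>{t \<in> ?I. g t = j}. \<bar>\<kappa> ! t\<bar>) = \<bar>\<nu> ! j\<bar>" if "j < ?l" for j
        using M that S_col[of f g j] fk by (simp add: S NN_def)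
      \<comment> \<open>Conversely, a negative row or column makes the entry nonpositive; it is
        nonzero because \<open>h t\<close> is a cell of \<open>M\<close>.\<close>
      have neg: "\<kappa> ! t < 0" if "t \<in> ?I" "\<mu> ! f t < 0 \<or> \<nu> ! g t < 0" for t
      proof -
        have "M $$ (f t, g t) \<le> 0" using NN_nonpos[OF M] fk gl that by blast
        moreover have "h t = (f t, g t)" using that by (simp add: f g)
        ultimately have "M $$ h t < 0" using cellsD(3)[OF M hc[OF that(1)]] by simp
        then show ?thesis using h that by (auto simp: X_def refine_maps_def)
      qed
      have "f \<in> extensional ?I" "g \<in> extensional ?I" by (auto simp: f g)
      then show "f \<in> list_refinements \<kappa> \<mu> \<and> g \<in> list_refinements \<kappa> \<nu>"
        using fk gl row col neg by (auto simp: refine_maps_def PiE_def)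
    qed
  qed
  then have "card (list_refinements \<kappa> \<mu> \<times> list_refinements \<kappa> \<nu>) = card (SIGMA M:NN \<mu> \<nu>. X M)"
    by (rule bij_betw_same_card)
  also have "\<dots> = (\<Sum>M\<in>NN \<mu> \<nu>. card (X M))"
    by (intro card_SigmaI finite_NN ballI) (auto simp: X_def intro: finite_refine_maps)
  finally show ?thesis
    by (simp add: card_cartesian_product X_def card_list_refinements_comp_mat)
qed

text \<open>Grouping matrices by their composition turns the right side into a sum over
  \<open>NN \<mu> \<nu>\<close>. By \<open>wt_mat_negw\<close> every matrix carries the same power
  of q, which leaves the counting identity \<open>card_list_refinements_mult\<close>.\<close>

lemma d_coeff_diag_mult:
  fixes q :: "'r::comm_semiring_1"
  assumes \<kappa>: "0 \<notin> set \<kappa>" and \<mu>: "\<mu> \<in> signed_compositions n" and \<nu>: "\<nu> \<in> signed_compositions n"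
  shows "d_coeff \<kappa> \<mu> \<kappa> q * d_coeff \<kappa> \<nu> \<kappa> q
    = (\<Sum>\<sigma>\<in>signed_compositions n. d_coeff \<mu> \<nu> \<sigma> q * d_coeff \<kappa> \<sigma> \<kappa> q)"
proof -
  have nz: "0 \<notin> set \<mu>" "0 \<notin> set \<nu>" using \<mu> \<nu> by (auto simp: signed_compositions_def)
  have "(\<Sum>\<sigma>\<in>signed_compositions n. d_coeff \<mu> \<nu> \<sigma> q * d_coeff \<kappa> \<sigma> \<kappa> q)
    = (\<Sum>\<sigma>\<in>signed_compositions n. \<Sum>M\<in>{M \<in> NN \<mu> \<nu>. comp_mat M = \<sigma>}.
         q ^ wt_mat \<mu> \<nu> M * d_coeff \<kappa> (comp_mat M) \<kappa> q)"
    unfolding d_coeff_def[of \<mu>] sum_distrib_right by (intro sum.cong) auto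
  also have "\<dots> = (\<Sum>M\<in>NN \<mu> \<nu>. q ^ wt_mat \<mu> \<nu> M * d_coeff \<kappa> (comp_mat M) \<kappa> q)"
    by (intro sum.group finite_NN finite_signed_compositions) (use comp_mat_signed_composition[OF \<mu>] in auto)
  also have "\<dots> = (\<Sum>M\<in>NN \<mu> \<nu>. q ^ (negw \<mu> + negw \<nu>) * of_nat (card (list_refinements \<kappa> (comp_mat M))))"
  proof (intro sum.cong refl)
    fix M assume M: "M \<in> NN \<mu> \<nu>"
    have "0 \<notin> set (comp_mat M)" by (auto simp: comp_mat_def)
    then show "q ^ wt_mat \<mu> \<nu> M * d_coeff \<kappa> (comp_mat M) \<kappa> q
      = q ^ (negw \<mu> + negw \<nu>) * of_nat (card (list_refinements \<kappa> (comp_mat M)))"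
      unfolding wt_mat_negw[OF M nz, symmetric] by (simp add: d_coeff_diag \<kappa> power_add mult.assoc)
  qed
  also have "\<dots> = q ^ (negw \<mu> + negw \<nu>) * of_nat (card (list_refinements \<kappa> \<mu>) * card (list_refinements \<kappa> \<nu>))"
    by (simp add: card_list_refinements_mult \<kappa> nz sum_distrib_left del: of_nat_mult)
  finally show ?thesis
    by (simp add: d_coeff_diag \<kappa> nz power_add mult_ac)
qed

text \<open>With one positive block the constant map is the only refinement and no power of q
  appears. This settles the relator \<open>gen [int n] - 1\<close>.\<close>

lemma d_coeff_diag_unit:
  assumes \<kappa>: "\<kappa> \<in> signed_compositions n" and n: "n \<ge> 1"
  shows "d_coeff \<kappa> [int n] \<kappa> q = 1"
proof -
  let ?z = "restrict (\<lambda>i. 0 :: nat) {..<length \<kappa>}"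
  have sum: "(\<Sum>i<length \<kappa>. \<bar>\<kappa> ! i\<bar>) = int n"
    using \<kappa> by (simp add: signed_compositions_def sum_list_sum_nth atLeast0LessThan)
  have "{i \<in> {..<length \<kappa>}. ?z i = 0} = {..<length \<kappa>}" by auto
  then have "?z \<in> list_refinements \<kappa> [int n]"
    unfolding refine_maps_def using sum by (simp add: lessThan_Suc)
  moreover have "f = ?z" if "f \<in> list_refinements \<kappa> [int n]" for f
  proof
    fix i show "f i = ?z i"
      using that by (cases "i < length \<kappa>") (auto simp: refine_maps_def PiE_def extensional_def)
  qed
  ultimately have "list_refinements \<kappa> [int n] = {?z}" by blast
  moreover have "0 \<notin> set \<kappa>" using \<kappa> by (simp add: signed_compositions_def)
  ultimately show ?thesis using n by (simp add: d_coeff_diag negw_def)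
qed

subsection \<open>The algebra and its one-dimensional modules\<close>

lemma poly_mapping_sum_singles:
  "(\<Sum>w\<in>Poly_Mapping.keys f. Poly_Mapping.single w (Poly_Mapping.lookup f w)) = f"
proof (rule poly_mapping_eqI)
  fix v
  show "Poly_Mapping.lookup (\<Sum>w\<in>Poly_Mapping.keys f. Poly_Mapping.single w (Poly_Mapping.lookup f w)) v
    = Poly_Mapping.lookup f v"
    by (simp add: lookup_sum lookup_single when_def in_keys_iff)
qed

lemma eval_free_single:
  "eval_free q \<kappa> (Poly_Mapping.single w c) = c * (\<Prod>\<alpha>\<leftarrow>letters w. d_coeff \<kappa> \<alpha> \<kappa> q)"
  by (simp add: eval_free_def)

lemma eval_free_add: "eval_free q \<kappa> (f + g) = eval_free q \<kappa> f + eval_free q \<kappa> g"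
  unfolding eval_free_def by (rule setsum_keys_plus_distrib) (simp_all add: distrib_right)

lemma eval_free_zero [simp]: "eval_free q \<kappa> 0 = 0"
  by (simp add: eval_free_def)

lemma eval_free_sum: "eval_free q \<kappa> (sum f A) = (\<Sum>x\<in>A. eval_free q \<kappa> (f x))"
  by (induction A rule: infinite_finite_induct) (simp_all add: eval_free_add)

lemma eval_free_diff: "eval_free q \<kappa> (f - g) = eval_free q \<kappa> f - eval_free q \<kappa> g"
  using eval_free_add[of q \<kappa> "f - g" g] by simp

text \<open>After expansion into single words, concatenating words multiplies the products over
  their letters.\<close>

lemma eval_free_mult: "eval_free q \<kappa> (f * g) = eval_free q \<kappa> f * eval_free q \<kappa> g"
proof -
  let ?s = "\<lambda>f w. Poly_Mapping.single w (Poly_Mapping.lookup f w)"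
  have "f * g = (\<Sum>w\<in>Poly_Mapping.keys f. ?s f w) * (\<Sum>v\<in>Poly_Mapping.keys g. ?s g v)"
    by (simp add: poly_mapping_sum_singles)
  also have "\<dots> = (\<Sum>w\<in>Poly_Mapping.keys f. \<Sum>v\<in>Poly_Mapping.keys g. ?s f w * ?s g v)"
    by (rule sum_product)
  finally have "eval_free q \<kappa> (f * g)
      = (\<Sum>w\<in>Poly_Mapping.keys f. \<Sum>v\<in>Poly_Mapping.keys g. eval_free q \<kappa> (?s f w * ?s g v))"
    by (simp add: eval_free_sum)
  also have "\<dots> = eval_free q \<kappa> f * eval_free q \<kappa> g"
    unfolding eval_free_def[of _ _ f] eval_free_def[of _ _ g] sum_product
    by (simp add: mult_single eval_free_single plus_word_def mult_ac)
  finally show ?thesis .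
qed

lemma eval_free_scalar [simp]: "eval_free q \<kappa> (scalar c) = c"
  by (simp add: scalar_def eval_free_single zero_word_def)

lemma scalar_one [simp]: "scalar 1 = 1"
  by (simp add: scalar_def)

lemma scalar_zero [simp]: "scalar 0 = 0"
  by (simp add: scalar_def)

lemma scalar_add: "scalar (c + d) = scalar c + scalar d"
  by (simp add: scalar_def single_add)

lemma scalar_mult: "scalar (c * d) = scalar c * scalar d"
  by (simp add: scalar_def mult_single)

lemma eval_free_one [simp]: "eval_free q \<kappa> 1 = 1"
  using eval_free_scalar[of q \<kappa> 1] by simp

lemma eval_free_gen [simp]: "eval_free q \<kappa> (gen \<alpha>) = d_coeff \<kappa> \<alpha> \<kappa> q"
  by (simp add: gen_def eval_free_single)

text \<open>Scalars are supported on the empty word, the neutral element of the word monoid, so they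
  are central.\<close>

lemma scalar_commute: "scalar c * f = f * scalar c"
proof -
  have "scalar c * Poly_Mapping.single w a = Poly_Mapping.single w a * scalar c" for w a
    by (simp add: scalar_def mult_single mult.commute)
  then have "scalar c * (\<Sum>w\<in>Poly_Mapping.keys f. Poly_Mapping.single w (Poly_Mapping.lookup f w))
    = (\<Sum>w\<in>Poly_Mapping.keys f. Poly_Mapping.single w (Poly_Mapping.lookup f w)) * scalar c"
    by (simp add: sum_distrib_left sum_distrib_right)
  then show ?thesis by (simp add: poly_mapping_sum_singles)
qed

section \<open>The free algebra as a ring, and the ideal of relations\<close>

lemma free_algebra_simps [simp]:
  "mult (free_algebra n) = (*)" "one (free_algebra n) = 1"
  "zero (free_algebra n) = 0" "add (free_algebra n) = (+)"
  by (simp_all add: free_algebra_def)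

lemma free_algebra_closed:
  shows free_zero: "0 \<in> carrier (free_algebra n)"
    and free_add: "f \<in> carrier (free_algebra n) \<Longrightarrow> g \<in> carrier (free_algebra n) \<Longrightarrow> f + g \<in> carrier (free_algebra n)"
    and free_mult: "f \<in> carrier (free_algebra n) \<Longrightarrow> g \<in> carrier (free_algebra n) \<Longrightarrow> f * g \<in> carrier (free_algebra n)"
    and free_uminus: "f \<in> carrier (free_algebra n) \<Longrightarrow> - f \<in> carrier (free_algebra n)"
    and free_single: "set (letters w) \<subseteq> signed_compositions n \<Longrightarrow> Poly_Mapping.single w c \<in> carrier (free_algebra n)"
proof -
  show "f \<in> carrier (free_algebra n) \<Longrightarrow> g \<in> carrier (free_algebra n) \<Longrightarrow> f + g \<in> carrier (free_algebra n)"
    using keys_add[of f g] by (auto simp: free_algebra_def)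
  show "f \<in> carrier (free_algebra n) \<Longrightarrow> g \<in> carrier (free_algebra n) \<Longrightarrow> f * g \<in> carrier (free_algebra n)"
    using keys_mult[of f g] by (fastforce simp: free_algebra_def plus_word_def)
  show "f \<in> carrier (free_algebra n) \<Longrightarrow> - f \<in> carrier (free_algebra n)"
    by (auto simp: free_algebra_def keys.rep_eq)
qed (auto simp: free_algebra_def)

lemma free_scalar: "scalar c \<in> carrier (free_algebra n)"
  by (auto simp: scalar_def zero_word_def intro: free_single)

lemma free_one: "1 \<in> carrier (free_algebra n)"
  using free_scalar[of 1] by simp

lemma free_gen: "\<mu> \<in> signed_compositions n \<Longrightarrow> gen \<mu> \<in> carrier (free_algebra n)"
  by (auto simp: gen_def intro: free_single)

lemma free_diff: "f \<in> carrier (free_algebra n) \<Longrightarrow> g \<in> carrier (free_algebra n) \<Longrightarrow> f - g \<in> carrier (free_algebra n)"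
  using free_add[of f n "- g"] free_uminus[of g n] by simp

lemma free_sum: "(\<And>x. x \<in> A \<Longrightarrow> f x \<in> carrier (free_algebra n)) \<Longrightarrow> sum f A \<in> carrier (free_algebra n)"
  by (induction A rule: infinite_finite_induct) (auto intro: free_zero free_add)

lemmas free_closed = free_algebra_closed free_scalar free_one free_gen free_diff free_sum

lemma ring_free_algebra: "ring (free_algebra n :: 'r::field free ring)"
proof (rule ringI)
  show "abelian_group (free_algebra n :: 'r free ring)"
  proof (rule abelian_groupI)
    fix f :: "'r free" assume "f \<in> carrier (free_algebra n)"
    then show "\<exists>g\<in>carrier (free_algebra n). g \<oplus>\<^bsub>free_algebra n\<^esub> f = \<zero>\<^bsub>free_algebra n\<^esub>"
      by (intro bexI[of _ "- f"]) (auto intro: free_uminus)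
  qed (auto intro: free_closed simp: add_ac)
  show "monoid (free_algebra n :: 'r free ring)"
    by (rule monoidI) (auto intro: free_closed simp: mult.assoc)
qed (auto simp: distrib_left distrib_right)

lemma relators_carrier:
  assumes n: "n \<ge> 1"
  shows "relators n q \<subseteq> carrier (free_algebra n)"
proof -
  have "[int n] \<in> signed_compositions n" using n by (simp add: signed_compositions_def)
  then show ?thesis by (auto simp: relators_def intro!: free_closed)
qed

lemma ideal_rel_ideal: "n \<ge> 1 \<Longrightarrow> ideal (rel_ideal n q) (free_algebra n)"
  unfolding rel_ideal_def by (rule ring.genideal_ideal[OF ring_free_algebra relators_carrier])

text \<open>The kernel of the character is an ideal containing all relators, hence it contains the
  ideal they generate.\<close>

lemma eval_free_rel_ideal:
  assumes n: "n \<ge> 1" and \<kappa>: "\<kappa> \<in> signed_compositions n" and f: "f \<in> rel_ideal n q"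
  shows "eval_free q \<kappa> f = 0"
proof -
  let ?K = "{f \<in> carrier (free_algebra n). eval_free q \<kappa> f = 0}"
  interpret ring "free_algebra n" by (rule ring_free_algebra)
  have nz: "0 \<notin> set \<kappa>" using \<kappa> by (simp add: signed_compositions_def)
  have "ideal ?K (free_algebra n)"
  proof (rule idealI[OF ring_free_algebra])
    show "subgroup ?K (add_monoid (free_algebra n))"
    proof (rule group.subgroupI[OF a_group])
      show "?K \<noteq> {}" using free_zero by auto
      fix f assume f: "f \<in> ?K"
      have "inv\<^bsub>add_monoid (free_algebra n)\<^esub> f = - f"
        using f by (intro comm_monoid.comm_inv_char[OF a_comm_monoid]) (auto intro: free_uminus)
      then show "inv\<^bsub>add_monoid (free_algebra n)\<^esub> f \<in> ?K"
        using f eval_free_diff[of q \<kappa> 0 f] by (auto intro: free_uminus)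
    qed (auto intro: free_add simp: eval_free_add)
  qed (auto intro: free_mult simp: eval_free_mult)
  moreover have "relators n q \<subseteq> ?K"
  proof
    fix r assume r: "r \<in> relators n q"
    then have "eval_free q \<kappa> r = 0"
      unfolding relators_def
      by (auto simp: eval_free_diff eval_free_mult eval_free_sum d_coeff_diag_mult[OF nz] d_coeff_diag_unit[OF \<kappa> n])
    then show "r \<in> ?K" using relators_carrier[OF n] r by auto
  qed
  ultimately show ?thesis
    using f genideal_minimal[of ?K "relators n q"] unfolding rel_ideal_def by blast
qed

section \<open>The quotient algebra and the irreducibility of its one-dimensional modules\<close>

abbreviation coset :: "nat \<Rightarrow> 'r::field \<Rightarrow> 'r free \<Rightarrow> 'r free set" where
  "coset n q f \<equiv> rel_ideal n q +>\<^bsub>free_algebra n\<^esub> f"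

context
  fixes n :: nat and q :: "'r::field"
  assumes n: "n \<ge> 1"
begin

interpretation I: ideal "rel_ideal n q" "free_algebra n"
  by (rule ideal_rel_ideal[OF n])

lemma ring_Sigma: "ring (Sigma_alg n q)"
  unfolding Sigma_alg_def by (rule I.quotient_is_ring)

lemma carrier_Sigma: "carrier (Sigma_alg n q) = coset n q ` carrier (free_algebra n)"
  by (auto simp: Sigma_alg_def FactRing_def A_RCOSETS_def')

lemma coset_add:
  "f \<in> carrier (free_algebra n) \<Longrightarrow> g \<in> carrier (free_algebra n) \<Longrightarrow>
    coset n q f \<oplus>\<^bsub>Sigma_alg n q\<^esub> coset n q g = coset n q (f + g)"
  using ring_hom_add[OF I.rcos_ring_hom] by (simp add: Sigma_alg_def)

lemma coset_mult:
  "f \<in> carrier (free_algebra n) \<Longrightarrow> g \<in> carrier (free_algebra n) \<Longrightarrow>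
    coset n q f \<otimes>\<^bsub>Sigma_alg n q\<^esub> coset n q g = coset n q (f * g)"
  using ring_hom_mult[OF I.rcos_ring_hom] by (simp add: Sigma_alg_def)

lemma coset_one: "\<one>\<^bsub>Sigma_alg n q\<^esub> = coset n q 1"
  using ring_hom_one[OF I.rcos_ring_hom] by (simp add: Sigma_alg_def)

lemma coset_eqI:
  assumes f: "f \<in> carrier (free_algebra n)" and g: "g \<in> carrier (free_algebra n)" and "f - g \<in> relators n q"
  shows "coset n q f = coset n q g"
proof -
  have "f - g \<in> rel_ideal n q"
    unfolding rel_ideal_def using I.genideal_self[OF relators_carrier[OF n]] assms(3) by blast
  then have "f \<in> coset n q g"
    unfolding a_r_coset_def' by (auto intro!: bexI[of _ "f - g"])
  then show ?thesis using I.a_repr_independence'[OF _ g] by simp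
qed

text \<open>The character is constant on the coset, so its image there is a singleton and
  \<open>the_elem\<close> returns the value at the representative.\<close>

lemma I_mod_smult:
  assumes \<kappa>: "\<kappa> \<in> signed_compositions n" and f: "f \<in> carrier (free_algebra n)"
  shows "coset n q f \<odot>\<^bsub>I_mod q \<kappa>\<^esub> v = eval_free q \<kappa> f * v"
proof -
  have "0 \<in> rel_ideal n q" using additive_subgroup.zero_closed[OF I.additive_subgroup_axioms] by simp
  then have "eval_free q \<kappa> ` coset n q f = {eval_free q \<kappa> f}"
    using eval_free_rel_ideal[OF n \<kappa>] by (force simp: a_r_coset_def' eval_free_add)
  then show ?thesis by (simp add: I_mod_def)
qed

lemma abelian_group_I_mod: "abelian_group (I_mod q \<kappa> :: ('r free set, 'r) module)"
proof (rule abelian_groupI)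
  fix x assume "x \<in> carrier (I_mod q \<kappa> :: ('r free set, 'r) module)"
  show "\<exists>y\<in>carrier (I_mod q \<kappa>). y \<oplus>\<^bsub>I_mod q \<kappa>\<^esub> x = \<zero>\<^bsub>I_mod q \<kappa>\<^esub>"
    by (auto simp: I_mod_def intro!: exI[of _ "- x"])
qed (auto simp: I_mod_def add_ac)

lemma irreducible_I_mod:
  assumes \<kappa>: "\<kappa> \<in> signed_compositions n"
  shows "irreducible_module (Sigma_alg n q) (I_mod q \<kappa>)"
proof -
  have [simp]: "carrier (I_mod q \<kappa>) = UNIV" "add (I_mod q \<kappa>) = (+)" "zero (I_mod q \<kappa>) = 0"
    by (simp_all add: I_mod_def)
  have "left_module (Sigma_alg n q) (I_mod q \<kappa>)"
  proof (intro left_module.intro left_module_axioms.intro ring_Sigma abelian_group_I_mod)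
    fix a b x assume "a \<in> carrier (Sigma_alg n q)" "b \<in> carrier (Sigma_alg n q)"
    then obtain f g where f: "f \<in> carrier (free_algebra n)" "a = coset n q f"
      and g: "g \<in> carrier (free_algebra n)" "b = coset n q g"
      by (auto simp: carrier_Sigma)
    show "(a \<oplus>\<^bsub>Sigma_alg n q\<^esub> b) \<odot>\<^bsub>I_mod q \<kappa>\<^esub> x = a \<odot>\<^bsub>I_mod q \<kappa>\<^esub> x \<oplus>\<^bsub>I_mod q \<kappa>\<^esub> b \<odot>\<^bsub>I_mod q \<kappa>\<^esub> x"
      using f g by (simp add: coset_add I_mod_smult \<kappa> free_add eval_free_add distrib_right)
    show "(a \<otimes>\<^bsub>Sigma_alg n q\<^esub> b) \<odot>\<^bsub>I_mod q \<kappa>\<^esub> x = a \<odot>\<^bsub>I_mod q \<kappa>\<^esub> (b \<odot>\<^bsub>I_mod q \<kappa>\<^esub> x)"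
      using f g by (simp add: coset_mult I_mod_smult \<kappa> free_mult eval_free_mult mult.assoc)
  next
    fix a x y
    show "a \<odot>\<^bsub>I_mod q \<kappa>\<^esub> (x \<oplus>\<^bsub>I_mod q \<kappa>\<^esub> y) = a \<odot>\<^bsub>I_mod q \<kappa>\<^esub> x \<oplus>\<^bsub>I_mod q \<kappa>\<^esub> a \<odot>\<^bsub>I_mod q \<kappa>\<^esub> y"
      by (simp add: I_mod_def distrib_left)
  next
    fix x
    show "\<one>\<^bsub>Sigma_alg n q\<^esub> \<odot>\<^bsub>I_mod q \<kappa>\<^esub> x = x"
      by (simp add: coset_one I_mod_smult \<kappa> free_one)
  qed auto
  moreover have "H = {0} \<or> H = UNIV" if "submodule H (Sigma_alg n q) (I_mod q \<kappa>)" for H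
  proof (rule disjCI)
    interpret H: submodule H "Sigma_alg n q" "I_mod q \<kappa>" by (rule that)
    have "0 \<in> H" using H.one_closed by simp
    assume "H \<noteq> UNIV"
    then obtain u where u: "u \<notin> H" by blast
    have "v = 0" if "v \<in> H" for v
    proof (rule ccontr)
      assume "v \<noteq> 0"
      \<comment> \<open>Scalars belong to the algebra, so a nonzero \<open>v\<close> in
        \<open>H\<close> would drag the excluded element \<open>u\<close> into
        \<open>H\<close>.\<close>
      have "coset n q (scalar (u / v)) \<odot>\<^bsub>I_mod q \<kappa>\<^esub> v \<in> H"
        using that by (intro H.smult_closed) (auto simp: carrier_Sigma free_scalar)
      then show False using u \<open>v \<noteq> 0\<close> by (simp add: I_mod_smult \<kappa> free_scalar)
    qed
    then show "H = {0}" using \<open>0 \<in> H\<close> by blast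
  qed
  moreover have "(UNIV :: 'r set) \<noteq> {0}" by (metis UNIV_I singletonD zero_neq_one)
  ultimately show ?thesis by (auto simp: irreducible_module_def)
qed

end

text \<open>An isomorphism respects the scalars contained in the algebra, so it is linear over the
  field and equates the two characters. Their nonvanishing at their own indices then yields
  refinements in both directions.\<close>

lemma mset_eq_if_I_mod_isomorphic:
  fixes q :: "'r::field_char_0"
  assumes n: "n \<ge> 1" and q: "q \<noteq> 0"
    and \<kappa>: "\<kappa> \<in> signed_compositions n" and \<mu>: "\<mu> \<in> signed_compositions n"
    and iso: "module_isomorphic (Sigma_alg n q) (I_mod q \<kappa>) (I_mod q \<mu>)"
  shows "mset \<kappa> = mset \<mu>"
proof -
  obtain h where h: "h \<in> iso (add_monoid (I_mod q \<kappa> :: ('r free set, 'r) module)) (add_monoid (I_mod q \<mu> :: ('r free set, 'r) module))"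
    and lin: "\<And>a x. a \<in> carrier (Sigma_alg n q) \<Longrightarrow> h (a \<odot>\<^bsub>I_mod q \<kappa>\<^esub> x) = a \<odot>\<^bsub>I_mod q \<mu>\<^esub> h x"
    using iso by (auto simp: module_isomorphic_def I_mod_def)
  have lin': "h (eval_free q \<kappa> f * x) = eval_free q \<mu> f * h x" if "f \<in> carrier (free_algebra n)" for f x
    using lin[of "coset n q f" x] that by (simp add: carrier_Sigma[OF n] I_mod_smult[OF n] \<kappa> \<mu>)
  have "bij h" using h by (simp add: iso_def I_mod_def)
  moreover have "h 0 = 0" using lin'[OF free_zero, of 0] by simp
  ultimately have h1: "h 1 \<noteq> 0" by (metis bij_pointE zero_neq_one)
  have "d_coeff \<kappa> \<alpha> \<kappa> q = d_coeff \<mu> \<alpha> \<mu> q" if \<alpha>: "\<alpha> \<in> signed_compositions n" for \<alpha>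
  proof -
    have "h (d_coeff \<kappa> \<alpha> \<kappa> q * 1) = d_coeff \<mu> \<alpha> \<mu> q * h 1"
      using lin'[OF free_gen[OF \<alpha>], of 1] by simp
    moreover have "h (d_coeff \<kappa> \<alpha> \<kappa> q * 1) = d_coeff \<kappa> \<alpha> \<kappa> q * h 1"
      using lin'[OF free_scalar, of "d_coeff \<kappa> \<alpha> \<kappa> q" 1] by simp
    ultimately show ?thesis using h1 by simp
  qed
  moreover have nz: "0 \<notin> set \<kappa>" "0 \<notin> set \<mu>" using \<kappa> \<mu> by (auto simp: signed_compositions_def)
  moreover have "finite (list_refinements \<kappa> \<kappa>)" "finite (list_refinements \<mu> \<mu>)"
    by (auto intro: finite_refine_maps)
  then have "card (list_refinements \<kappa> \<kappa>) \<noteq> 0" "card (list_refinements \<mu> \<mu>) \<noteq> 0"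
    using list_refinements_refl nz by auto
  \<comment> \<open>The characters are compared at \<open>\<kappa>\<close> and at
    \<open>\<mu>\<close>. The powers of q cancel, and in characteristic zero \<open>of_nat\<close>
    vanishes only at 0.\<close>
  ultimately have "card (list_refinements \<mu> \<kappa>) \<noteq> 0" "card (list_refinements \<kappa> \<mu>) \<noteq> 0"
    using \<kappa> \<mu> q by (metis d_coeff_diag mult_cancel_left of_nat_eq_0_iff power_eq_0_iff)+
  then have "list_refinements \<mu> \<kappa> \<noteq> {}" "list_refinements \<kappa> \<mu> \<noteq> {}" by fastforce+
  then show ?thesis using mset_eq_of_mutual_refinements nz by blast
qed

subsection \<open>Irreducible modules\<close>

locale Sigma_module =
  fixes n :: nat and q :: "'r::field" and M :: "('r free set, 'm) module" (structure)
  assumes n: "n \<ge> 1" and left_module: "left_module (Sigma_alg n q) M"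
begin

interpretation LM: left_module "Sigma_alg n q" M by (rule left_module)

text \<open>Pulling the action back to the free algebra replaces computations with cosets by
  ordinary sums and products.\<close>

definition act :: "'r free \<Rightarrow> 'm \<Rightarrow> 'm" where
  "act f x = coset n q f \<odot> x"

abbreviation "F \<equiv> carrier (free_algebra n :: 'r free ring)"

lemma act_closed: "f \<in> F \<Longrightarrow> x \<in> carrier M \<Longrightarrow> act f x \<in> carrier M"
  unfolding act_def by (rule LM.smult_closed) (auto simp: carrier_Sigma[OF n])

lemma act_add: "f \<in> F \<Longrightarrow> g \<in> F \<Longrightarrow> x \<in> carrier M \<Longrightarrow> act (f + g) x = act f x \<oplus> act g x"
  unfolding act_def coset_add[OF n, symmetric] by (rule LM.smult_l_distr) (auto simp: carrier_Sigma[OF n])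

lemma act_mult: "f \<in> F \<Longrightarrow> g \<in> F \<Longrightarrow> x \<in> carrier M \<Longrightarrow> act (f * g) x = act f (act g x)"
  unfolding act_def coset_mult[OF n, symmetric] by (rule LM.smult_assoc) (auto simp: carrier_Sigma[OF n])

lemma act_one: "x \<in> carrier M \<Longrightarrow> act 1 x = x"
  unfolding act_def coset_one[OF n, symmetric] by (rule LM.smult_one)

lemma act_plus: "f \<in> F \<Longrightarrow> x \<in> carrier M \<Longrightarrow> y \<in> carrier M \<Longrightarrow> act f (x \<oplus> y) = act f x \<oplus> act f y"
  unfolding act_def by (rule LM.smult_r_distr) (auto simp: carrier_Sigma[OF n])

lemma act_zero: "x \<in> carrier M \<Longrightarrow> act 0 x = \<zero>"
  using act_add[OF free_zero free_zero] act_closed[OF free_zero]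
  by (metis LM.M.add.r_cancel_one' add_0)

lemma act_zero_right: "f \<in> F \<Longrightarrow> act f \<zero> = \<zero>"
  by (metis LM.M.add.r_cancel_one' LM.M.r_zero LM.M.zero_closed act_closed act_plus)

lemma act_sum_zero:
  "(\<And>t. t \<in> T \<Longrightarrow> f t \<in> F \<and> act (f t) x = \<zero>) \<Longrightarrow> x \<in> carrier M \<Longrightarrow> act (sum f T) x = \<zero>"
  by (induction T rule: infinite_finite_induct) (auto simp: act_zero act_add free_sum)

lemma act_uminus: "f \<in> F \<Longrightarrow> x \<in> carrier M \<Longrightarrow> act (- f) x = \<ominus> act f x"
  using act_add[of "- f" f x]
  by (intro LM.M.minus_equality[symmetric]) (auto simp: act_zero act_closed free_uminus)

text \<open>The relator \<open>gen [int n] - 1\<close> identifies this generator with the identity.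
  Hence on a nonzero module some generator acts nontrivially.\<close>

lemma act_unit: "x \<in> carrier M \<Longrightarrow> act (gen [int n]) x = x"
proof -
  assume x: "x \<in> carrier M"
  have "[int n] \<in> signed_compositions n" using n by (simp add: signed_compositions_def)
  then have "coset n q (gen [int n]) = coset n q 1"
    by (intro coset_eqI[OF n] free_closed) (auto simp: relators_def)
  then show ?thesis using act_one[OF x] by (simp add: act_def)
qed

lemma act_gen_gen:
  assumes \<mu>: "\<mu> \<in> signed_compositions n" and \<nu>: "\<nu> \<in> signed_compositions n" and x: "x \<in> carrier M"
  shows "act (gen \<mu>) (act (gen \<nu>) x)
    = act (\<Sum>\<tau>\<in>signed_compositions n. scalar (d_coeff \<mu> \<nu> \<tau> q) * gen \<tau>) x"
proof -
  have "coset n q (gen \<mu> * gen \<nu>) = coset n q (\<Sum>\<tau>\<in>signed_compositions n. scalar (d_coeff \<mu> \<nu> \<tau> q) * gen \<tau>)"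
    using \<mu> \<nu> by (intro coset_eqI[OF n] free_closed) (auto simp: relators_def)
  then have "act (gen \<mu> * gen \<nu>) x = act (\<Sum>\<tau>\<in>signed_compositions n. scalar (d_coeff \<mu> \<nu> \<tau> q) * gen \<tau>) x"
    by (simp add: act_def)
  then show ?thesis using act_mult[OF free_gen[OF \<mu>] free_gen[OF \<nu>] x] by simp
qed

text \<open>Closure under additive inverses follows from the action of \<open>- 1\<close>.\<close>

lemma submoduleI:
  assumes "H \<subseteq> carrier M" "\<zero> \<in> H" "\<And>x y. x \<in> H \<Longrightarrow> y \<in> H \<Longrightarrow> x \<oplus> y \<in> H"
    and act: "\<And>f x. f \<in> F \<Longrightarrow> x \<in> H \<Longrightarrow> act f x \<in> H"
  shows "submodule H (Sigma_alg n q) M"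
proof (intro submodule.intro submodule_axioms.intro)
  show "subgroup H (add_monoid M)"
  proof (rule group.subgroupI[OF LM.M.a_group])
    fix x assume x: "x \<in> H"
    then have "x \<in> carrier M" using assms(1) by blast
    then have "act (- 1) x = \<ominus> x" using act_uminus[OF free_one] act_one by simp
    then have "\<ominus> x \<in> H" using act[OF free_uminus[OF free_one] x] by simp
    then show "inv\<^bsub>add_monoid M\<^esub> x \<in> H" by (simp add: a_inv_def)
  qed (use assms in auto)
  show "a \<odot> x \<in> H" if "a \<in> carrier (Sigma_alg n q)" "x \<in> H" for a x
    using act that by (auto simp: act_def carrier_Sigma[OF n])
qed

section \<open>Scalar action forced by a generator of maximal rank that acts nontrivially\<close>

context
  fixes \<sigma> :: "int list"
  assumes irr: "irreducible_module (Sigma_alg n q) M"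
    and \<sigma>: "\<sigma> \<in> signed_compositions n"
    and nonzero: "\<exists>x\<in>carrier M. act (gen \<sigma>) x \<noteq> \<zero>"
    and higher: "\<And>\<tau> x. \<tau> \<in> signed_compositions n \<Longrightarrow> rank \<tau> > rank \<sigma> \<Longrightarrow> x \<in> carrier M \<Longrightarrow> act (gen \<tau>) x = \<zero>"
begin

text \<open>In the expansion of the product every term other than \<open>\<sigma>\<close> has
  coefficient zero or higher rank, and generators of higher rank annihilate the module.\<close>

lemma act_top_gen:
  assumes \<beta>: "\<beta> \<in> signed_compositions n" and x: "x \<in> carrier M"
  shows "act (gen \<sigma>) (act (gen \<beta>) x) = act (scalar (d_coeff \<sigma> \<beta> \<sigma> q)) (act (gen \<sigma>) x)"
proof -
  let ?t = "\<lambda>\<tau>. scalar (d_coeff \<sigma> \<beta> \<tau> q) * gen \<tau>"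
  have t: "?t \<tau> \<in> F" if "\<tau> \<in> signed_compositions n" for \<tau> using that by (intro free_closed)
  have zero: "act (?t \<tau>) x = \<zero>" if \<tau>: "\<tau> \<in> signed_compositions n - {\<sigma>}" for \<tau>
  proof (cases "d_coeff \<sigma> \<beta> \<tau> q = 0")
    case True
    then show ?thesis using x by (simp add: act_zero)
  next
    case False
    then have "rank \<tau> > rank \<sigma>"
      using d_coeff_nonzero_rank[of \<sigma> \<beta> \<tau> q] \<sigma> \<tau> by (auto simp: signed_compositions_def)
    then show ?thesis
      using \<tau> x higher by (simp add: act_mult free_scalar free_gen act_zero_right)
  qed
  have rest: "sum ?t (signed_compositions n - {\<sigma>}) \<in> F" by (intro free_sum t) auto
  have "act (sum ?t (signed_compositions n - {\<sigma>})) x = \<zero>"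
    using t zero x by (intro act_sum_zero) auto
  then have "act (sum ?t (signed_compositions n)) x = act (?t \<sigma>) x"
    using t[OF \<sigma>] rest \<sigma> x
    by (simp add: sum.remove[OF finite_signed_compositions \<sigma>] act_add act_closed)
  then show ?thesis
    using \<sigma> \<beta> x by (simp add: act_gen_gen act_mult free_scalar free_gen)
qed

lemma act_top_word:
  assumes "set ws \<subseteq> signed_compositions n" and x: "x \<in> carrier M"
  shows "act (gen \<sigma>) (act (Poly_Mapping.single (Word ws) 1) x)
    = act (scalar (eval_free q \<sigma> (Poly_Mapping.single (Word ws) 1))) (act (gen \<sigma>) x)"
  using assms(1)
proof (induction ws)
  case Nil
  have "(Poly_Mapping.single (Word []) 1 :: 'r free) = 1"
    by (simp flip: zero_word_def)
  then show ?case using \<sigma> x by (simp add: act_one act_closed free_gen)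
next
  case (Cons \<beta> ws)
  define g :: "'r free" where "g = Poly_Mapping.single (Word ws) 1"
  have eq: "Poly_Mapping.single (Word (\<beta> # ws)) 1 = gen \<beta> * g"
    by (simp add: g_def gen_def mult_single plus_word_def)
  have \<beta>: "\<beta> \<in> signed_compositions n" and g: "g \<in> F" using Cons.prems by (auto simp: g_def intro!: free_single)
  have IH: "act (gen \<sigma>) (act g x) = act (scalar (eval_free q \<sigma> g)) (act (gen \<sigma>) x)"
    using Cons by (simp add: g_def)
  have "act (gen \<sigma>) (act (gen \<beta> * g) x) = act (scalar (d_coeff \<sigma> \<beta> \<sigma> q)) (act (gen \<sigma>) (act g x))"
    using \<beta> g x by (simp add: act_mult free_gen act_top_gen act_closed)
  also have "\<dots> = act (scalar (eval_free q \<sigma> (gen \<beta> * g))) (act (gen \<sigma>) x)"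
    using \<sigma> x by (simp add: IH eval_free_mult scalar_mult act_mult free_scalar act_closed free_gen)
  finally show ?case by (simp add: eq)
qed

text \<open>Both sides are additive in \<open>f\<close>, so words suffice; their coefficients move
  past \<open>gen \<sigma>\<close> because scalars are central.\<close>

lemma act_top:
  assumes f: "f \<in> F" and x: "x \<in> carrier M"
  shows "act (gen \<sigma>) (act f x) = act (scalar (eval_free q \<sigma> f)) (act (gen \<sigma>) x)"
proof -
  define s where "s w = Poly_Mapping.single w (Poly_Mapping.lookup f w)" for w
  have gx: "act (gen \<sigma>) x \<in> carrier M" using \<sigma> x by (simp add: act_closed free_gen)
  have w: "set (letters w) \<subseteq> signed_compositions n" if "w \<in> Poly_Mapping.keys f" for w
    using f that by (auto simp: free_algebra_def)
  have "act (gen \<sigma>) (act (s w) x) = act (scalar (eval_free q \<sigma> (s w))) (act (gen \<sigma>) x)"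
    if "w \<in> Poly_Mapping.keys f" for w
  proof -
    define c where "c = Poly_Mapping.lookup f w"
    define g :: "'r free" where "g = Poly_Mapping.single w 1"
    have g: "g \<in> F" unfolding g_def using w[OF that] by (rule free_single)
    have s: "s w = scalar c * g"
      by (simp add: s_def c_def g_def scalar_def mult_single)
    have "act (gen \<sigma>) (act (s w) x) = act (gen \<sigma> * scalar c) (act g x)"
      using \<sigma> g x by (simp add: s act_mult free_gen free_scalar act_closed)
    also have "\<dots> = act (scalar c) (act (gen \<sigma>) (act g x))"
      using \<sigma> g x by (simp add: scalar_commute[symmetric] act_mult free_gen free_scalar act_closed)
    also have "act (gen \<sigma>) (act g x) = act (scalar (eval_free q \<sigma> g)) (act (gen \<sigma>) x)"
      using act_top_word[of "letters w"] w[OF that] x by (simp add: g_def)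
    also have "act (scalar c) \<dots> = act (scalar (eval_free q \<sigma> (s w))) (act (gen \<sigma>) x)"
      using gx by (simp add: s eval_free_mult scalar_mult act_mult free_scalar)
    finally show ?thesis .
  qed
  moreover have "s w \<in> F" if "w \<in> Poly_Mapping.keys f" for w
    unfolding s_def using w[OF that] by (rule free_single)
  moreover have "(\<forall>w\<in>W. act (gen \<sigma>) (act (s w) x) = act (scalar (eval_free q \<sigma> (s w))) (act (gen \<sigma>) x) \<and> s w \<in> F)
      \<Longrightarrow> act (gen \<sigma>) (act (sum s W) x) = act (scalar (eval_free q \<sigma> (sum s W))) (act (gen \<sigma>) x)" for W
    using gx \<sigma> x
    by (induction W rule: infinite_finite_induct)
       (simp_all add: act_zero act_zero_right free_gen free_sum act_add act_plus act_closed
         eval_free_add scalar_add free_scalar)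
  ultimately have "act (gen \<sigma>) (act (sum s (Poly_Mapping.keys f)) x)
      = act (scalar (eval_free q \<sigma> (sum s (Poly_Mapping.keys f)))) (act (gen \<sigma>) x)"
    by blast
  then show ?thesis unfolding s_def poly_mapping_sum_singles .
qed

text \<open>By \<open>act_top\<close> the kernel of \<open>gen \<sigma>\<close> is a submodule, and it contains every
  \<open>act (f - scalar (eval_free q \<sigma> f)) x\<close>.\<close>

lemma act_scalar:
  assumes f: "f \<in> F" and x: "x \<in> carrier M"
  shows "act f x = act (scalar (eval_free q \<sigma> f)) x"
proof -
  define K where "K = {x \<in> carrier M. act (gen \<sigma>) x = \<zero>}"
  have "submodule K (Sigma_alg n q) M"
    unfolding K_def using \<sigma>
    by (intro submoduleI) (auto simp: act_zero_right free_gen act_plus act_top act_closed free_scalar)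
  \<comment> \<open>The kernel is not everything, since \<open>gen \<sigma>\<close> acts
    nontrivially, so irreducibility makes it zero.\<close>
  then have K: "K = {\<zero>}"
    using irr nonzero unfolding irreducible_module_def by (auto simp: K_def)
  let ?s = "scalar (eval_free q \<sigma> f)"
  have d: "f - ?s \<in> F" using f by (intro free_closed)
  then have "act (f - ?s) x \<in> K"
    using x \<sigma> by (simp add: K_def act_closed act_top eval_free_diff act_zero free_gen)
  then have "act (f - ?s) x = \<zero>" using K by blast
  then show ?thesis
    using act_add[OF d free_scalar x, of "eval_free q \<sigma> f"] x by (simp add: act_closed free_scalar)
qed

text \<open>Every element acts as a scalar, so the multiples of one nonzero vector \<open>x\<close>
  form a nonzero submodule, which is all of \<open>M\<close>. The map \<open>\<psi>\<close>
  identifies the field with these multiples.\<close>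

lemma isomorphic_I_mod:
  assumes \<kappa>: "\<kappa> \<in> signed_compositions n" and mset: "mset \<kappa> = mset \<sigma>"
  shows "module_isomorphic (Sigma_alg n q) M (I_mod q \<kappa>)"
proof -
  let ?I = "I_mod q \<kappa> :: ('r free set, 'r) module"
  have [simp]: "carrier ?I = UNIV" "add ?I = (+)" by (simp_all add: I_mod_def)
  have nz: "0 \<notin> set \<kappa>" "0 \<notin> set \<sigma>" using \<kappa> \<sigma> by (auto simp: signed_compositions_def)
  \<comment> \<open>The scalar action was found for \<open>\<sigma>\<close>; the characters of its
    rearrangement \<open>\<kappa>\<close> and of \<open>\<sigma>\<close> agree.\<close>
  have chi: "eval_free q \<kappa> f = eval_free q \<sigma> f" if f: "f \<in> F" for f
  proof -
    have "d_coeff \<kappa> \<alpha> \<kappa> q = d_coeff \<sigma> \<alpha> \<sigma> q" if "\<alpha> \<in> signed_compositions n" for \<alpha>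
    proof -
      have "0 \<notin> set \<alpha>" using that by (simp add: signed_compositions_def)
      then show ?thesis using card_list_refinements_perm[OF mset] nz by (simp add: d_coeff_diag)
    qed
    then have "map (\<lambda>\<alpha>. d_coeff \<kappa> \<alpha> \<kappa> q) (letters w) = map (\<lambda>\<alpha>. d_coeff \<sigma> \<alpha> \<sigma> q) (letters w)"
      if "w \<in> Poly_Mapping.keys f" for w
      using f that by (auto simp: free_algebra_def)
    then show ?thesis unfolding eval_free_def by (metis (no_types, lifting) sum.cong)
  qed
  obtain x where x: "x \<in> carrier M" "x \<noteq> \<zero>"
    using irr unfolding irreducible_module_def by fastforce
  define \<psi> where "\<psi> c = act (scalar c) x" for c
  have \<psi>_closed: "\<psi> c \<in> carrier M" for c using x by (simp add: \<psi>_def act_closed free_scalar)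
  have \<psi>_add: "\<psi> (c + d) = \<psi> c \<oplus> \<psi> d" for c d
    using x by (simp add: \<psi>_def scalar_add act_add free_scalar)
  have \<psi>_act: "act f (\<psi> c) = \<psi> (eval_free q \<sigma> f * c)" if "f \<in> F" for f c
    using act_scalar[OF that \<psi>_closed, of c] x by (simp add: \<psi>_def scalar_mult act_mult free_scalar)
  have \<psi>0: "\<psi> 0 = \<zero>" using x by (simp add: \<psi>_def act_zero)
  have \<psi>1: "\<psi> 1 = x" using x by (simp add: \<psi>_def act_one)
  have "submodule (range \<psi>) (Sigma_alg n q) M"
    by (rule submoduleI) (auto simp: \<psi>_closed \<psi>_act \<psi>_add[symmetric] \<psi>0[symmetric])
  moreover have "range \<psi> \<noteq> {\<zero>}" using \<psi>1 x by (metis rangeI singletonD)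
  ultimately have range: "range \<psi> = carrier M" using irr unfolding irreducible_module_def by blast
  have "inj \<psi>"
  proof (rule injI, rule ccontr)
    fix c d assume eq: "\<psi> c = \<psi> d" and "c \<noteq> d"
    have "\<psi> (c - d) \<oplus> \<psi> d = \<psi> d" using \<psi>_add[of "c - d" d] eq by simp
    then have "\<psi> (c - d) = \<zero>" using \<psi>_closed by (metis LM.M.add.r_cancel_one')
    \<comment> \<open>Dividing by the nonzero difference recovers \<open>x\<close> from a vector
      that is zero, a contradiction.\<close>
    moreover have "act (scalar (1 / (c - d))) (\<psi> (c - d)) = x"
      using \<psi>_act[OF free_scalar, of "1 / (c - d)" "c - d"] \<open>c \<noteq> d\<close> \<psi>1 by simp
    ultimately show False using x act_zero_right[OF free_scalar] by simp
  qed
  then have iso: "\<psi> \<in> iso (add_monoid ?I) (add_monoid M)"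
    using range by (auto simp: iso_def hom_def bij_betw_def \<psi>_closed \<psi>_add)
  \<comment> \<open>The isomorphism sought starts at \<open>M\<close>, so \<open>\<psi>\<close> has
    to be inverted.\<close>
  define h where "h = inv_into (carrier (add_monoid ?I)) \<psi>"
  have "h \<in> iso (add_monoid M) (add_monoid ?I)"
    unfolding h_def using group.iso_set_sym[OF abelian_group.a_group[OF abelian_group_I_mod[OF n]] iso] .
  moreover have h: "h (\<psi> c) = c" for c using \<open>inj \<psi>\<close> by (simp add: h_def)
  moreover have "h (a \<odot> y) = a \<odot>\<^bsub>?I\<^esub> h y" if a: "a \<in> carrier (Sigma_alg n q)" and y: "y \<in> carrier M" for a y
  proof -
    obtain f where f: "f \<in> F" "a = coset n q f" using a by (auto simp: carrier_Sigma[OF n])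
    obtain c where c: "y = \<psi> c" using y range by auto
    have "a \<odot> y = \<psi> (eval_free q \<sigma> f * c)" using \<psi>_act[OF f(1)] by (simp add: f c act_def)
    then show ?thesis by (simp add: h c f I_mod_smult[OF n \<kappa>] chi)
  qed
  ultimately show ?thesis unfolding module_isomorphic_def by blast
qed

end

text \<open>The set \<open>S\<close> of generators acting nontrivially is finite and contains the
  identity generator, so it has a member of maximal rank, whose decreasing rearrangement is the
  required signed partition.\<close>

lemma irreducible_isomorphic_I_mod:
  assumes irr: "irreducible_module (Sigma_alg n q) M"
  shows "\<exists>\<kappa>\<in>signed_partitions n. module_isomorphic (Sigma_alg n q) M (I_mod q \<kappa>)"
proof -
  define S where "S = {\<sigma> \<in> signed_compositions n. \<exists>x\<in>carrier M. act (gen \<sigma>) x \<noteq> \<zero>}"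
  obtain x where x: "x \<in> carrier M" "x \<noteq> \<zero>"
    using irr unfolding irreducible_module_def by fastforce
  have "[int n] \<in> S"
    using n x by (auto simp: S_def signed_compositions_def act_unit intro!: bexI[of _ x])
  moreover have fin: "finite (rank ` S)" using finite_signed_compositions by (simp add: S_def)
  ultimately have "Max (rank ` S) \<in> rank ` S" by (intro Max_in) auto
  then obtain \<sigma> where \<sigma>: "\<sigma> \<in> S" "rank \<sigma> = Max (rank ` S)" by auto
  have max: "rank \<tau> \<le> rank \<sigma>" if "\<tau> \<in> S" for \<tau>
    unfolding \<sigma>(2) using fin that by simp
  have higher: "act (gen \<tau>) y = \<zero>"
    if "\<tau> \<in> signed_compositions n" "rank \<tau> > rank \<sigma>" "y \<in> carrier M" for \<tau> y
    using max[of \<tau>] that by (force simp: S_def)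
  let ?\<kappa> = "rev (sort \<sigma>)"
  have mset: "mset ?\<kappa> = mset \<sigma>" by simp
  then have "(\<Sum>a\<leftarrow>?\<kappa>. \<bar>a\<bar>) = (\<Sum>a\<leftarrow>\<sigma>. \<bar>a\<bar>)" by (metis mset_map sum_mset_sum_list)
  then have \<kappa>: "?\<kappa> \<in> signed_compositions n"
    using \<sigma> by (simp add: S_def signed_compositions_def)
  moreover have "?\<kappa> \<in> signed_partitions n"
    using \<kappa> by (simp add: signed_partitions_def sorted_wrt_rev)
  moreover have "module_isomorphic (Sigma_alg n q) M (I_mod q ?\<kappa>)"
    using \<sigma> by (intro isomorphic_I_mod[OF irr _ _ higher \<kappa> mset]) (auto simp: S_def)
  ultimately show ?thesis by blast
qed

end

text \<open>The clauses on \<open>E_gen\<close> and \<open>scalar_Sigma\<close> certify that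
  \<open>I_mod\<close> is the intended one-dimensional module. Completeness is asserted for modules
  over an arbitrary carrier type \<open>'m\<close>.\<close>

theorem theorem8p7:
  fixes n :: nat and q :: "'r::field_char_0"
  assumes "n \<ge> 1" and "q \<noteq> 0"
  shows "(\<forall>\<kappa>\<in>signed_partitions n.
            irreducible_module (Sigma_alg n q) (I_mod q \<kappa>) \<and>
            (\<forall>\<alpha>\<in>signed_compositions n. \<forall>v. E_gen n q \<alpha> \<odot>\<^bsub>I_mod q \<kappa>\<^esub> v = d_coeff \<kappa> \<alpha> \<kappa> q * v) \<and>
            (\<forall>c v. scalar_Sigma n q c \<odot>\<^bsub>I_mod q \<kappa>\<^esub> v = c * v)) \<and>
         (\<forall>\<kappa>\<in>signed_partitions n. \<forall>\<mu>\<in>signed_partitions n.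
            \<kappa> \<noteq> \<mu> \<longrightarrow> \<not> module_isomorphic (Sigma_alg n q) (I_mod q \<kappa>) (I_mod q \<mu>)) \<and>
         (\<forall>M :: ('r free set, 'm) module. irreducible_module (Sigma_alg n q) M \<longrightarrow>
            (\<exists>\<kappa>\<in>signed_partitions n. module_isomorphic (Sigma_alg n q) M (I_mod q \<kappa>)))"
proof (intro conjI ballI allI impI)
  fix \<kappa> assume "\<kappa> \<in> signed_partitions n"
  then have \<kappa>: "\<kappa> \<in> signed_compositions n" by (simp add: signed_partitions_def)
  show "irreducible_module (Sigma_alg n q) (I_mod q \<kappa>)"
    by (rule irreducible_I_mod[OF assms(1) \<kappa>])
  show "E_gen n q \<alpha> \<odot>\<^bsub>I_mod q \<kappa>\<^esub> v = d_coeff \<kappa> \<alpha> \<kappa> q * v" if "\<alpha> \<in> signed_compositions n" for \<alpha> v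
    using I_mod_smult[OF assms(1) \<kappa> free_gen[OF that]] by (simp add: E_gen_def)
  show "scalar_Sigma n q c \<odot>\<^bsub>I_mod q \<kappa>\<^esub> v = c * v" for c v
    using I_mod_smult[OF assms(1) \<kappa> free_scalar] by (simp add: scalar_Sigma_def)
next
  fix \<kappa> \<mu> assume "\<kappa> \<in> signed_partitions n" "\<mu> \<in> signed_partitions n" "\<kappa> \<noteq> \<mu>"
  then show "\<not> module_isomorphic (Sigma_alg n q) (I_mod q \<kappa>) (I_mod q \<mu>)"
    using mset_eq_if_I_mod_isomorphic[OF assms, of \<kappa> \<mu>] signed_partition_eqI[of \<kappa> n \<mu>]
    by (auto simp: signed_partitions_def)
next
  fix M :: "('r free set, 'm) module" assume irr: "irreducible_module (Sigma_alg n q) M"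
  then interpret Sigma_module n q M
    by (intro Sigma_module.intro assms(1)) (simp add: irreducible_module_def)
  show "\<exists>\<kappa>\<in>signed_partitions n. module_isomorphic (Sigma_alg n q) M (I_mod q \<kappa>)"
    by (rule irreducible_isomorphic_I_mod[OF irr])
qed

end
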